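(* Let $(O,C,E)$ and $(O',C',E')$ be local M-polyfold models and let $f:O\to O'$ be an sc-diffeomorphism. Then $$d_C(x)=d_{C'}(f(x))$$ at each point $x\in O$.
   Context: An sc-structure on a Banach space $E$ is a nested sequence $E=E_0\supset E_1\supset\cdots$ of Banach spaces such that every inclusion $E_{m+1}\to E_m$ is compact and $E_\infty:=\bigcap_m E_m$ is dense in every $E_m$; $E$ is then an sc-Banach space. $|\cdot|_m$ is the norm of $E_m$. $E\oplus F$ has levels $E_m\oplus F_m$; $E^k$ is $E_k$ with levels $(E^k)_m=E_{k+m}$. A linear map $T:E\to F$ is an sc-operator if it maps $E_m$ continuously into $F_m$ for all $m$; a linear sc-isomorphism is a bijective sc-operator whose inverse is an sc-operator. A partial quadrant in $E$ is a closed subset $C\subset E$ for which there are an sc-Banach space $W$, an integer $k\ge0$ and a linear sc-isomorphism $T:E\to\mathbb R^k\oplus W$ with $T(C)=[0,\infty)^k\oplus W$. For $x\in C$ with $T(x)=(r_1,\dots,r_k,w)$ the degeneration index is $d_C(x)=\#\{i\in\{1,\dots,k\}: r_i=0\}$ (independent of $T$). A relatively open $U\subset C$ has levels $U_m=U\cap E_m$; $U^k$ is $U_k$ with levels $U_{k+m}$; $TU=U^1\oplus E$. A map $f:U\to V$ between relatively open subsets of partial quadrants in $E$, $F$ is $\mathrm{sc}^0$ if $f(U_m)\subset V_m$ and $f:U_m\to V_m$ is continuous for all $m$. An $\mathrm{sc}^0$-map is $\mathrm{sc}^1$ if for every $x\in U_1$ there is a bounded linear operator $Df(x):E_0\to F_0$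 such that (1) $\lim_{|h|_1\to0}\frac1{|h|_1}|f(x+h)-f(x)-Df(x)h|_0=0$ for $h\in E_1$, $x+h\in C$; (2) $Tf:TU\to TV$, $(x,h)\mapsto(f(x),Df(x)h)$, is $\mathrm{sc}^0$. Inductively $f$ is $\mathrm{sc}^{k+1}$ if it is $\mathrm{sc}^1$ and $Tf$ is $\mathrm{sc}^k$; sc-smooth means $\mathrm{sc}^k$ for all $k$. An sc-smooth retraction is an sc-smooth map $r:U\to U$, $U$ relatively open in a partial quadrant $C$, with $r\circ r=r$. A local M-polyfold model is a triple $(O,C,E)$ with $E$ an sc-Banach space, $C\subset E$ a partial quadrant and $O\subset C$ such that: (1) $O=r(U)$ for some sc-smooth retraction $r:U\to U$, $U\subset C$ relatively open; (2) for every smooth point $x\in O_\infty=O\cap E_\infty$ the kernel of $\mathrm{id}-Dr(x)$ has an sc-complement contained in $C$; (3) for every $x\in O$ there is a sequence $(x_k)\subset O_\infty$ converging to $x$ in $O$ with $d_C(x_k)=d_C(x)$. (The choice of $r$ is irrelevant.) A map $f:O\to O'$ between local models is $\mathrm{sc}^k$ if $f\circ r:U\to E'$ is $\mathrm{sc}^k$ for an (equivalently any) sc-smooth retraction $r:U\to U$ with $r(U)=O$, $U\subset C$ relatively open. An sc-diffeomorphism is a bijection $f:O\to O'$ such that $f$ and $f^{-1}$ are sc-smooth. *)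

theory Defs
  imports "HOL-Analysis.Analysis" "HOL-Library.Function_Algebras"
begin

instantiation "fun" :: (type, real_vector) real_vector
begin

definition "scaleR c f = (\<lambda>x. c *\<^sub>R f x)"

instance
  by standard (simp_all add: scaleR_fun_def fun_eq_iff scaleR_add_right scaleR_add_left)

end

section \<open>Sc-structures\<close>

text \<open>The spaces \<open>E\<^sub>m\<close> are subspaces of an ambient real vector space \<^typ>\<open>'a\<close>; the ambient type itself
  carries no norm, and \<open>E\<^sub>0\<close> need not be all of it. Only the values of \<open>lnorm E m\<close> on \<open>level E m\<close>
  are meaningful.\<close>

record 'a sc_space =
  level :: "nat \<Rightarrow> 'a set"
  lnorm :: "nat \<Rightarrow> 'a \<Rightarrow> real"

definition norm_on :: "'a::real_vector set \<Rightarrow> ('a \<Rightarrow> real) \<Rightarrow> bool" where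
  "norm_on V n \<longleftrightarrow>
     (\<forall>x\<in>V. 0 \<le> n x) \<and> (\<forall>x\<in>V. n x = 0 \<longleftrightarrow> x = 0) \<and>
     (\<forall>x\<in>V. \<forall>c. n (c *\<^sub>R x) = \<bar>c\<bar> * n x) \<and>
     (\<forall>x\<in>V. \<forall>y\<in>V. n (x + y) \<le> n x + n y)"

text \<open>The case distinction is there because the locale \<^locale>\<open>Metric_space\<close> asks for a
  nonnegative symmetric function on the whole type.\<close>

definition level_dist :: "'a::real_vector sc_space \<Rightarrow> nat \<Rightarrow> 'a \<Rightarrow> 'a \<Rightarrow> real" where
  "level_dist E m x y = (if x \<in> level E m \<and> y \<in> level E m then lnorm E m (x - y) else 0)"

definition level_top :: "'a::real_vector sc_space \<Rightarrow> nat \<Rightarrow> 'a topology" where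
  "level_top E m = Metric_space.mtopology (level E m) (level_dist E m)"

definition normed_levels :: "'a::real_vector sc_space \<Rightarrow> bool" where
  "normed_levels E \<longleftrightarrow>
     (\<forall>m. subspace (level E m) \<and> norm_on (level E m) (lnorm E m) \<and> level E (Suc m) \<subseteq> level E m)"

definition smooth_points :: "'a sc_space \<Rightarrow> 'a set" where
  "smooth_points E = (\<Inter>m. level E m)"

definition sc_Banach :: "'a::real_vector sc_space \<Rightarrow> bool" where
  "sc_Banach E \<longleftrightarrow>
     normed_levels E \<and>
     (\<forall>m. Metric_space.mcomplete (level E m) (level_dist E m)) \<and>
     (\<forall>m. compactin (level_top E m)
            (level_top E m closure_of {x \<in> level E (Suc m). lnorm E (Suc m) x \<le> 1})) \<and>
     (\<forall>m. level_top E m closure_of smooth_points E = level E m)"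

definition sc_sum :: "'a sc_space \<Rightarrow> 'b sc_space \<Rightarrow> ('a \<times> 'b) sc_space" where
  "sc_sum E F = \<lparr>level = (\<lambda>m. level E m \<times> level F m),
                 lnorm = (\<lambda>m (x, y). lnorm E m x + lnorm F m y)\<rparr>"

definition sc_shift :: "nat \<Rightarrow> 'a sc_space \<Rightarrow> 'a sc_space" where
  "sc_shift k E = \<lparr>level = (\<lambda>m. level E (k + m)), lnorm = (\<lambda>m. lnorm E (k + m))\<rparr>"

definition sc_restrict :: "'a sc_space \<Rightarrow> 'a set \<Rightarrow> 'a sc_space" where
  "sc_restrict E V = \<lparr>level = (\<lambda>m. level E m \<inter> V), lnorm = lnorm E\<rparr>"

text \<open>\<open>\<real>\<^sup>k\<close> with the constant sc-structure; vectors are sequences vanishing from index \<open>k\<close> on.\<close>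

definition sc_Rn :: "nat \<Rightarrow> (nat \<Rightarrow> real) sc_space" where
  "sc_Rn k = \<lparr>level = (\<lambda>_. {r. \<forall>i\<ge>k. r i = 0}), lnorm = (\<lambda>_ r. L2_set r {..<k})\<rparr>"

definition linear_on_set :: "'a::real_vector set \<Rightarrow> ('a \<Rightarrow> 'b::real_vector) \<Rightarrow> bool" where
  "linear_on_set V T \<longleftrightarrow>
     (\<forall>x\<in>V. \<forall>y\<in>V. T (x + y) = T x + T y) \<and> (\<forall>x\<in>V. \<forall>c. T (c *\<^sub>R x) = c *\<^sub>R T x)"

definition sc_operator ::
  "'a::real_vector sc_space \<Rightarrow> 'b::real_vector sc_space \<Rightarrow> ('a \<Rightarrow> 'b) \<Rightarrow> bool" where
  "sc_operator E F T \<longleftrightarrow>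
     linear_on_set (level E 0) T \<and> (\<forall>m. continuous_map (level_top E m) (level_top F m) T)"

definition sc_isomorphism ::
  "'a::real_vector sc_space \<Rightarrow> 'b::real_vector sc_space \<Rightarrow> ('a \<Rightarrow> 'b) \<Rightarrow> bool" where
  "sc_isomorphism E F T \<longleftrightarrow>
     bij_betw T (level E 0) (level F 0) \<and> sc_operator E F T \<and>
     sc_operator F E (inv_into (level E 0) T)"

text \<open>\<open>G\<close> is an sc-complement of \<open>K\<close>: both are sc-Banach spaces with the levels induced from \<open>E\<close>, and
  \<open>E = K \<oplus> G\<close> topologically on every level, i.e. addition is a linear sc-isomorphism.\<close>

definition sc_complement :: "'a::real_vector sc_space \<Rightarrow> 'a set \<Rightarrow> 'a set \<Rightarrow> bool" where
  "sc_complement E K G \<longleftrightarrow>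
     K \<subseteq> level E 0 \<and> G \<subseteq> level E 0 \<and>
     sc_Banach (sc_restrict E K) \<and> sc_Banach (sc_restrict E G) \<and>
     sc_isomorphism (sc_sum (sc_restrict E K) (sc_restrict E G)) E (\<lambda>(a, b). a + b)"


section \<open>Partial quadrants\<close>

text \<open>\<open>W\<close> is allowed to range over the sc-Banach spaces in the type of \<open>E\<close> only. This is no
  restriction: \<open>w \<mapsto> T\<inverse>(0, w)\<close> embeds any such \<open>W\<close> into \<open>E\<close>, and its norms can be transported
  along this embedding.\<close>

definition quadrant_chart ::
  "'a::real_vector sc_space \<Rightarrow> 'a set \<Rightarrow> nat \<Rightarrow> 'a sc_space \<Rightarrow> ('a \<Rightarrow> (nat \<Rightarrow> real) \<times> 'a) \<Rightarrow> bool"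
  where
  "quadrant_chart E C k W T \<longleftrightarrow>
     sc_Banach W \<and> sc_isomorphism E (sc_sum (sc_Rn k) W) T \<and>
     T ` C = {r \<in> level (sc_Rn k) 0. \<forall>i<k. 0 \<le> r i} \<times> level W 0"

definition partial_quadrant :: "'a::real_vector sc_space \<Rightarrow> 'a set \<Rightarrow> bool" where
  "partial_quadrant E C \<longleftrightarrow>
     closedin (level_top E 0) C \<and> (\<exists>k W T. quadrant_chart E C k W T)"

definition degeneration_index :: "'a::real_vector sc_space \<Rightarrow> 'a set \<Rightarrow> 'a \<Rightarrow> nat" where
  "degeneration_index E C x =
     (THE d. \<exists>k W T. quadrant_chart E C k W T \<and> d = card {i. i < k \<and> fst (T x) i = 0})"

definition relatively_open :: "'a::real_vector sc_space \<Rightarrow> 'a set \<Rightarrow> 'a set \<Rightarrow> bool" where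
  "relatively_open E C U \<longleftrightarrow> openin (subtopology (level_top E 0) C) U"


section \<open>Sc-smooth maps\<close>

definition sc0 ::
  "'a::real_vector sc_space \<Rightarrow> 'a set \<Rightarrow> 'b::real_vector sc_space \<Rightarrow> 'b set \<Rightarrow> ('a \<Rightarrow> 'b) \<Rightarrow> bool"
  where
  "sc0 E U F V f \<longleftrightarrow>
     (\<forall>m. continuous_map (subtopology (level_top E m) U) (subtopology (level_top F m) V) f)"

text \<open>The increments run over \<open>x + h \<in> U\<close> instead of \<open>x + h \<in> C\<close>, since \<open>f\<close> lives on \<open>U\<close> only; as \<open>U\<close> is
  relatively open in \<open>C\<close>, this agrees for small \<open>h\<close>. On \<open>E\<^sub>0\<close> the operator \<open>D\<close> is then unique.\<close>

definition has_sc_derivative ::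
  "'a::real_vector sc_space \<Rightarrow> 'a set \<Rightarrow> 'b::real_vector sc_space \<Rightarrow> ('a \<Rightarrow> 'b) \<Rightarrow> 'a \<Rightarrow> ('a \<Rightarrow> 'b) \<Rightarrow> bool"
  where
  "has_sc_derivative E U F f x D \<longleftrightarrow>
     linear_on_set (level E 0) D \<and> D ` level E 0 \<subseteq> level F 0 \<and>
     (\<exists>B. \<forall>h\<in>level E 0. lnorm F 0 (D h) \<le> B * lnorm E 0 h) \<and>
     (\<forall>\<epsilon>>0. \<exists>\<delta>>0. \<forall>h\<in>level E 1. x + h \<in> U \<and> 0 < lnorm E 1 h \<and> lnorm E 1 h < \<delta> \<longrightarrow>
        lnorm F 0 (f (x + h) - f x - D h) / lnorm E 1 h < \<epsilon>)"

definition tangent_space :: "'a sc_space \<Rightarrow> ('a \<times> 'a) sc_space" where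
  "tangent_space E = sc_sum (sc_shift 1 E) E"

definition tangent_set :: "'a sc_space \<Rightarrow> 'a set \<Rightarrow> ('a \<times> 'a) set" where
  "tangent_set E U = (U \<inter> level E 1) \<times> level E 0"

definition tangent_map :: "('a \<Rightarrow> 'b) \<Rightarrow> ('a \<Rightarrow> 'a \<Rightarrow> 'b) \<Rightarrow> 'a \<times> 'a \<Rightarrow> 'b \<times> 'b" where
  "tangent_map f D = (\<lambda>(x, h). (f x, D x h))"

text \<open>In \<open>sc\<^sup>k\<^sup>+\<^sup>1\<close> the recursion passes from \<open>f\<close> on \<^typ>\<open>'a\<close> to \<open>Tf\<close> on \<^typ>\<open>'a \<times> 'a\<close>, which HOL cannot
  express directly. The recursion is therefore carried out on the type of sequences, which absorbs
  pairs: \<open>seq_pair\<close> is a linear bijection that interleaves two sequences. A space is put into this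
  setting by \<open>seq_embed\<close>, and structures are transported along these injections. The lemmas
  \<open>sc_map_0\<close> and \<open>sc_map_Suc\<close> below show that \<open>sc_map\<close> satisfies the recursion that defines \<open>sc\<^sup>k\<close>.\<close>

definition seq_embed :: "'a::zero \<Rightarrow> nat \<Rightarrow> 'a" where
  "seq_embed x = (\<lambda>n. if n = 0 then x else 0)"

definition seq_pair :: "(nat \<Rightarrow> 'a) \<times> (nat \<Rightarrow> 'a) \<Rightarrow> nat \<Rightarrow> 'a" where
  "seq_pair = (\<lambda>(s, t) n. if even n then s (n div 2) else t (n div 2))"

definition transport :: "('a \<Rightarrow> 'b) \<Rightarrow> 'a sc_space \<Rightarrow> 'b sc_space" where
  "transport i E = \<lparr>level = (\<lambda>m. i ` level E m), lnorm = (\<lambda>m y. lnorm E m (inv i y))\<rparr>"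

primrec sc_map_seq ::
  "nat \<Rightarrow> (nat \<Rightarrow> 'a::real_vector) sc_space \<Rightarrow> (nat \<Rightarrow> 'a) set \<Rightarrow>
   (nat \<Rightarrow> 'b::real_vector) sc_space \<Rightarrow> (nat \<Rightarrow> 'b) set \<Rightarrow> ((nat \<Rightarrow> 'a) \<Rightarrow> nat \<Rightarrow> 'b) \<Rightarrow> bool" where
  "sc_map_seq 0 = (\<lambda>E U F V f. sc0 E U F V f)"
| "sc_map_seq (Suc k) = (\<lambda>E U F V f.
     sc0 E U F V f \<and>
     (\<exists>D. (\<forall>x \<in> U \<inter> level E 1. has_sc_derivative E U F f x (D x)) \<and>
          sc_map_seq k
            (transport seq_pair (tangent_space E)) (seq_pair ` tangent_set E U)
            (transport seq_pair (tangent_space F)) (seq_pair ` tangent_set F V)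
            (seq_pair \<circ> tangent_map f D \<circ> inv seq_pair)))"

definition sc_map ::
  "nat \<Rightarrow> 'a::real_vector sc_space \<Rightarrow> 'a set \<Rightarrow> 'b::real_vector sc_space \<Rightarrow> 'b set \<Rightarrow> ('a \<Rightarrow> 'b) \<Rightarrow> bool"
  where
  "sc_map k E U F V f \<longleftrightarrow>
     sc_map_seq k (transport seq_embed E) (seq_embed ` U) (transport seq_embed F) (seq_embed ` V)
       (seq_embed \<circ> f \<circ> inv seq_embed)"

definition sc_smooth ::
  "'a::real_vector sc_space \<Rightarrow> 'a set \<Rightarrow> 'b::real_vector sc_space \<Rightarrow> 'b set \<Rightarrow> ('a \<Rightarrow> 'b) \<Rightarrow> bool"
  where
  "sc_smooth E U F V f \<longleftrightarrow> (\<forall>k. sc_map k E U F V f)"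


section \<open>Local M-polyfold models\<close>

definition sc_smooth_retraction ::
  "'a::real_vector sc_space \<Rightarrow> 'a set \<Rightarrow> 'a set \<Rightarrow> ('a \<Rightarrow> 'a) \<Rightarrow> bool" where
  "sc_smooth_retraction E C U r \<longleftrightarrow>
     relatively_open E C U \<and> sc_smooth E U E U r \<and> (\<forall>x\<in>U. r (r x) = r x)"

definition local_model :: "'a::real_vector set \<Rightarrow> 'a set \<Rightarrow> 'a sc_space \<Rightarrow> bool" where
  "local_model Q C E \<longleftrightarrow>
     sc_Banach E \<and> partial_quadrant E C \<and> Q \<subseteq> C \<and>
     (\<exists>U r. sc_smooth_retraction E C U r \<and> Q = r ` U \<and>
        (\<forall>x \<in> Q \<inter> smooth_points E. \<exists>D. has_sc_derivative E U E r x D \<and>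
           (\<exists>G. sc_complement E {h \<in> level E 0. h - D h = 0} G \<and> G \<subseteq> C))) \<and>
     (\<forall>x\<in>Q. \<exists>s. (\<forall>n::nat. s n \<in> Q \<inter> smooth_points E \<and>
                       degeneration_index E C (s n) = degeneration_index E C x) \<and>
        limitin (subtopology (level_top E 0) Q) s x sequentially)"

definition model_sc_map ::
  "nat \<Rightarrow> 'a::real_vector set \<Rightarrow> 'a set \<Rightarrow> 'a sc_space \<Rightarrow> 'b::real_vector set \<Rightarrow> 'b sc_space \<Rightarrow>
   ('a \<Rightarrow> 'b) \<Rightarrow> bool" where
  "model_sc_map k Q C E Q' E' f \<longleftrightarrow>
     f ` Q \<subseteq> Q' \<and>
     (\<exists>U r. sc_smooth_retraction E C U r \<and> Q = r ` U \<and> sc_map k E U E' (level E' 0) (f \<circ> r))"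

definition sc_diffeomorphism ::
  "'a::real_vector set \<Rightarrow> 'a set \<Rightarrow> 'a sc_space \<Rightarrow>
   'b::real_vector set \<Rightarrow> 'b set \<Rightarrow> 'b sc_space \<Rightarrow> ('a \<Rightarrow> 'b) \<Rightarrow> bool" where
  "sc_diffeomorphism Q C E Q' C' E' f \<longleftrightarrow>
     bij_betw f Q Q' \<and> (\<forall>k. model_sc_map k Q C E Q' E' f) \<and>
     (\<forall>k. model_sc_map k Q' C' E' Q E (inv_into Q f))"


section \<open>The recursion for \<open>sc\<^sup>k\<close>\<close>

lemma Metric_space_level:
  assumes "normed_levels E"
  shows "Metric_space (level E m) (level_dist E m)"
proof -
  have sub: "subspace (level E m)" and n: "norm_on (level E m) (lnorm E m)"
    using assms by (auto simp: normed_levels_def)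
  have d: "x - y \<in> level E m" if "x \<in> level E m" "y \<in> level E m" for x y
    using sub that by (rule subspace_diff)
  show ?thesis
  proof
    show "0 \<le> level_dist E m x y" for x y
      using n d by (auto simp: level_dist_def norm_on_def)
    have "lnorm E m (x - y) = lnorm E m (y - x)" if "x \<in> level E m" "y \<in> level E m" for x y
    proof -
      have "lnorm E m ((- 1) *\<^sub>R (y - x)) = \<bar>- 1\<bar> * lnorm E m (y - x)"
        using n d[OF that(2,1)] unfolding norm_on_def by blast
      then show ?thesis by simp
    qed
    then show "level_dist E m x y = level_dist E m y x" for x y
      by (auto simp: level_dist_def)
    show "(level_dist E m x y = 0) = (x = y)" if "x \<in> level E m" "y \<in> level E m" for x y
      using n d[OF that] that by (auto simp: level_dist_def norm_on_def)
    show "level_dist E m x z \<le> level_dist E m x y + level_dist E m y z"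
      if "x \<in> level E m" "y \<in> level E m" "z \<in> level E m" for x y z
    proof -
      have "lnorm E m ((x - y) + (y - z)) \<le> lnorm E m (x - y) + lnorm E m (y - z)"
        using n d[OF that(1,2)] d[OF that(2,3)] unfolding norm_on_def by blast
      then show ?thesis using that by (simp add: level_dist_def)
    qed
  qed
qed

lemma topspace_level_top [simp]: "normed_levels E \<Longrightarrow> topspace (level_top E m) = level E m"
  by (simp add: level_top_def Metric_space.topspace_mtopology Metric_space_level)

lemma sc0_iff:
  assumes E: "normed_levels E" and F: "normed_levels F"
  shows "sc0 E U F V f \<longleftrightarrow>
    (\<forall>m. (\<forall>x \<in> level E m \<inter> U. f x \<in> level F m \<inter> V) \<and>
      (\<forall>x \<in> level E m \<inter> U. \<forall>\<epsilon>>0. \<exists>\<delta>>0. \<forall>y \<in> level E m \<inter> U.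
         lnorm E m (x - y) < \<delta> \<longrightarrow> lnorm F m (f x - f y) < \<epsilon>))"
proof -
  have sub: "subtopology (level_top G m) W = Metric_space.mtopology (level G m \<inter> W) (level_dist G m)"
    and ms: "Metric_space (level G m \<inter> W) (level_dist G m)"
    if "normed_levels G" for m W and G :: "'c::real_vector sc_space"
  proof -
    interpret Metric_space "level G m" "level_dist G m" using Metric_space_level[OF that] .
    interpret S: Submetric "level G m" "level_dist G m" "level G m \<inter> W"
      by unfold_locales auto
    show "subtopology (level_top G m) W = Metric_space.mtopology (level G m \<inter> W) (level_dist G m)"
      unfolding S.mtopology_submetric level_top_def
      by (metis subtopology_restrict topspace_mtopology)
    show "Metric_space (level G m \<inter> W) (level_dist G m)" ..
  qed
  show ?thesis
    unfolding sc0_def sub[OF E] sub[OF F]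
    apply (subst Metric_space.metric_continuous_map[OF ms[OF E] ms[OF F]])
    apply (intro iff_allI conj_cong)
     apply blast
    apply (rule ball_cong[OF refl])
    apply (rule all_cong1)
    apply (auto simp: level_dist_def image_subset_iff)
    done
qed

definition sc_embedding :: "('a::real_vector \<Rightarrow> 'b::real_vector) \<Rightarrow> 'a sc_space \<Rightarrow> 'b sc_space \<Rightarrow> bool"
  where
  "sc_embedding i E E' \<longleftrightarrow> inj i \<and> linear i \<and>
     (\<forall>m. level E' m = i ` level E m \<and> (\<forall>x\<in>level E m. lnorm E' m (i x) = lnorm E m x))"


lemma has_sc_derivative_level:
  "has_sc_derivative E U F f x D \<Longrightarrow> h \<in> level E 0 \<Longrightarrow> D h \<in> level F 0"
  by (auto simp: has_sc_derivative_def)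

lemma sc_embeddingD:
  assumes "sc_embedding i E E'"
  shows "inj i" "linear i" "level E' m = i ` level E m" "x \<in> level E m \<Longrightarrow> lnorm E' m (i x) = lnorm E m x"
    "i x \<in> level E' m \<longleftrightarrow> x \<in> level E m"
  using assms by (auto simp: sc_embedding_def inj_image_mem_iff)

lemma normed_levels_embedding:
  assumes i: "sc_embedding i E E'" and E: "normed_levels E"
  shows "normed_levels E'"
proof -
  note D = sc_embeddingD[OF i]
  interpret linear i by (rule D(2))
  have "subspace (level E' m)" for m
    unfolding D(3) using E D(2) by (intro linear_subspace_image) (auto simp: normed_levels_def)
  moreover have "norm_on (level E' m) (lnorm E' m)" for m
  proof -
    have sub: "subspace (level E m)" and n: "norm_on (level E m) (lnorm E m)"
      using E by (auto simp: normed_levels_def)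
    have z: "i x = 0 \<longleftrightarrow> x = 0" for x
      using D(1) zero by (metis injD)
    show ?thesis
      unfolding norm_on_def D(3)
      using n sub
      by (auto simp: D(4) z norm_on_def subspace_add subspace_scale simp flip: add scaleR)
  qed
  moreover have "level E' (Suc m) \<subseteq> level E' m" for m
    unfolding D(3) using E by (auto simp: normed_levels_def)
  ultimately show ?thesis by (simp add: normed_levels_def)
qed

lemma sc0_embedding:
  assumes i: "sc_embedding i E E'" and j: "sc_embedding j F F'"
    and E: "normed_levels E" and F: "normed_levels F"
    and g: "\<And>x. x \<in> U \<inter> level E 0 \<Longrightarrow> g (i x) = j (f x)"
  shows "sc0 E' (i ` U) F' (j ` V) g \<longleftrightarrow> sc0 E U F V f"
proof -
  note I = sc_embeddingD[OF i] and J = sc_embeddingD[OF j]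
  interpret i: linear i by (rule I(2))
  interpret j: linear j by (rule J(2))
  have nest: "level E m \<subseteq> level E 0" for m
    using E by (induction m) (auto simp: normed_levels_def)
  have g': "g (i x) = j (f x)" if "x \<in> level E m \<inter> U" for x m
    using that nest g by blast
  have lev: "level E' m \<inter> i ` U = i ` (level E m \<inter> U)" for m
    by (simp add: I(1,3) image_Int)
  have nE: "lnorm E' m (i x - i y) = lnorm E m (x - y)" if "x \<in> level E m" "y \<in> level E m" for x y m
    using that E by (simp add: I(4) normed_levels_def subspace_diff flip: i.diff)
  have nF: "lnorm F' m (j x - j y) = lnorm F m (x - y)" if "x \<in> level F m" "y \<in> level F m" for x y m
    using that F by (simp add: J(4) normed_levels_def subspace_diff flip: j.diff)
  have into: "(\<forall>x \<in> level E' m \<inter> i ` U. g x \<in> level F' m \<inter> j ` V) \<longleftrightarrow>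
              (\<forall>x \<in> level E m \<inter> U. f x \<in> level F m \<inter> V)" for m
    unfolding lev ball_simps 
    by (rule ball_cong[OF refl]) (simp add: g'[of _ m] J(1,5) inj_image_mem_iff)
  show ?thesis
    unfolding sc0_iff[OF E F] sc0_iff[OF normed_levels_embedding[OF i E] normed_levels_embedding[OF j F]]
      into
    unfolding lev
  proof (intro iff_allI conj_cong refl)
    fix m assume m: "\<forall>x\<in>level E m \<inter> U. f x \<in> level F m \<inter> V"
    have "lnorm E' m (i x - i y) = lnorm E m (x - y)" "lnorm F' m (g (i x) - g (i y)) = lnorm F m (f x - f y)"
      if "x \<in> level E m \<inter> U" "y \<in> level E m \<inter> U" for x y
      using m that by (simp_all add: g'[of _ m] nE nF)
    then show "(\<forall>x\<in>i ` (level E m \<inter> U). \<forall>\<epsilon>>0. \<exists>\<delta>>0. \<forall>y\<in>i ` (level E m \<inter> U).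
            lnorm E' m (x - y) < \<delta> \<longrightarrow> lnorm F' m (g x - g y) < \<epsilon>) \<longleftrightarrow>
        (\<forall>x\<in>level E m \<inter> U. \<forall>\<epsilon>>0. \<exists>\<delta>>0. \<forall>y\<in>level E m \<inter> U.
            lnorm E m (x - y) < \<delta> \<longrightarrow> lnorm F m (f x - f y) < \<epsilon>)"
      unfolding ball_simps by (intro ball_cong refl) simp
  qed
qed

lemma has_sc_derivative_embedding:
  assumes i: "sc_embedding i E E'" and j: "sc_embedding j F F'"
    and E: "normed_levels E" and F: "normed_levels F"
    and g: "\<And>x. x \<in> U \<inter> level E 0 \<Longrightarrow> g (i x) = j (f x)"
    and f: "sc0 E U F V f" and x: "x \<in> U \<inter> level E 1"
    and D: "\<And>h. h \<in> level E 0 \<Longrightarrow> D' (i h) = j (D h)"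
  shows "has_sc_derivative E' (i ` U) F' g (i x) D' \<longleftrightarrow> has_sc_derivative E U F f x D"
proof -
  note I = sc_embeddingD[OF i] and J = sc_embeddingD[OF j]
  interpret i: linear i by (rule I(2))
  interpret j: linear j by (rule J(2))
  have nest: "level E 1 \<subseteq> level E 0"
    using E by (auto simp: normed_levels_def)
  have subE: "subspace (level E m)" and subF: "subspace (level F m)" for m
    using E F by (auto simp: normed_levels_def)
  have fin: "f y \<in> level F 0" if "y \<in> U \<inter> level E 1" for y
    using f that nest unfolding sc0_iff[OF E F] by blast
  have g': "g (i y) = j (f y)" if "y \<in> U \<inter> level E 1" for y
    using that nest g by blast
  have lin: "linear_on_set (level E' 0) D' \<longleftrightarrow> linear_on_set (level E 0) D"
    using subE[of 0] J(1)
    by (auto simp: linear_on_set_def I(3) D subspace_add subspace_scale inj_eq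
        simp flip: i.add i.scaleR j.add j.scaleR)
  have into: "D' ` level E' 0 \<subseteq> level F' 0 \<longleftrightarrow> D ` level E 0 \<subseteq> level F 0"
    by (auto simp: I(3) D J(5) image_subset_iff)
  have bd: "(\<exists>B. \<forall>h\<in>level E' 0. lnorm F' 0 (D' h) \<le> B * lnorm E' 0 h) \<longleftrightarrow>
            (\<exists>B. \<forall>h\<in>level E 0. lnorm F 0 (D h) \<le> B * lnorm E 0 h)"
    if "D ` level E 0 \<subseteq> level F 0"
    using that by (auto simp: I(3) D I(4) J(4) image_subset_iff)
  have quot: "lnorm F' 0 (g (i x + i h) - g (i x) - D' (i h)) = lnorm F 0 (f (x + h) - f x - D h)"
    if "D ` level E 0 \<subseteq> level F 0" "h \<in> level E 1" "x + h \<in> U" for h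
  proof -
    have xh: "x + h \<in> U \<inter> level E 1"
      using that x subE[of 1] by (auto intro: subspace_add)
    have "g (i x + i h) - g (i x) - D' (i h) = j (f (x + h) - f x - D h)"
      using that(2) nest by (simp add: D g'[OF x] g'[OF xh] j.diff subset_iff flip: i.add)
    moreover have "f (x + h) - f x - D h \<in> level F 0"
      using fin[OF x] fin[OF xh] that nest by (auto intro!: subspace_diff[OF subF])
    ultimately show ?thesis by (simp add: J(4))
  qed
  have inU: "i x + i h \<in> i ` U \<longleftrightarrow> x + h \<in> U" for h
    by (simp add: I(1) inj_image_mem_iff flip: i.add)
  have lim: "(\<forall>h\<in>level E' 1. i x + h \<in> i ` U \<and> 0 < lnorm E' 1 h \<and> lnorm E' 1 h < \<delta> \<longrightarrow>
        lnorm F' 0 (g (i x + h) - g (i x) - D' h) / lnorm E' 1 h < \<epsilon>) \<longleftrightarrow>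
     (\<forall>h\<in>level E 1. x + h \<in> U \<and> 0 < lnorm E 1 h \<and> lnorm E 1 h < \<delta> \<longrightarrow>
        lnorm F 0 (f (x + h) - f x - D h) / lnorm E 1 h < \<epsilon>)"
    if "D ` level E 0 \<subseteq> level F 0" for \<delta> \<epsilon>
    unfolding I(3) ball_simps
    by (rule ball_cong[OF refl]) (use that in \<open>auto simp: inU I(4) quot\<close>)
  show ?thesis
  proof (cases "D ` level E 0 \<subseteq> level F 0")
    case True
    show ?thesis
      unfolding has_sc_derivative_def lin into bd[OF True] lim[OF True] ..
  next
    case False
    then show ?thesis
      unfolding has_sc_derivative_def into by blast
  qed
qed

lemma normed_levels_tangent_space:
  assumes "normed_levels E"
  shows "normed_levels (tangent_space E)"
proof -
  have n: "norm_on (V \<times> W) (\<lambda>(x, y). p x + q y)"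
    if "norm_on V p" "norm_on W q" for V :: "'a set" and W :: "'a set" and p q
    using that unfolding norm_on_def
    by (auto simp: add_nonneg_eq_0_iff zero_prod_def distrib_left)
       (meson add_mono add.commute add.left_commute order_trans | smt (verit))+
  show ?thesis
    using assms
    by (auto simp: normed_levels_def tangent_space_def sc_sum_def sc_shift_def n subspace_Times)
qed

lemma linear_seq_pair: "linear seq_pair"
  by (rule linearI) (auto simp: seq_pair_def fun_eq_iff scaleR_fun_def split: prod.splits)

lemma bij_seq_pair: "bij seq_pair"
proof (rule bijI')
  fix p q :: "(nat \<Rightarrow> 'a) \<times> (nat \<Rightarrow> 'a)"
  have "fst p n = seq_pair p (2 * n)" "snd p n = seq_pair p (2 * n + 1)"
    for p :: "(nat \<Rightarrow> 'a) \<times> (nat \<Rightarrow> 'a)" and n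
    by (auto simp: seq_pair_def split: prod.splits)
  then show "(seq_pair p = seq_pair q) = (p = q)"
    by (metis ext prod_eq_iff)
next
  fix s :: "nat \<Rightarrow> 'a"
  have "s = seq_pair (\<lambda>n. s (2 * n), \<lambda>n. s (2 * n + 1))"
    by (auto simp: seq_pair_def fun_eq_iff)
  then show "\<exists>p. s = seq_pair p" ..
qed

lemma seq_pair_eq_iff [simp]: "seq_pair p = seq_pair q \<longleftrightarrow> p = q"
  by (rule inj_eq[OF bij_is_inj[OF bij_seq_pair]])

lemma inv_seq_pair [simp]: "inv seq_pair (seq_pair p) = p" "seq_pair (inv seq_pair s) = s"
  by (rule inv_f_f[OF bij_is_inj[OF bij_seq_pair]], rule surj_f_inv_f[OF bij_is_surj[OF bij_seq_pair]])

lemma linear_seq_embed: "linear seq_embed"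
  by (rule linearI) (auto simp: seq_embed_def fun_eq_iff scaleR_fun_def)

lemma inj_seq_embed: "inj seq_embed"
  by (rule injI) (auto simp: seq_embed_def fun_eq_iff split: if_splits)

lemma sc_embedding_transport:
  "inj i \<Longrightarrow> linear i \<Longrightarrow> sc_embedding i E (transport i E)"
  by (simp add: sc_embedding_def transport_def)

lemma sc_embedding_comp:
  "sc_embedding i E E' \<Longrightarrow> sc_embedding k E' E'' \<Longrightarrow> sc_embedding (k \<circ> i) E E''"
  unfolding sc_embedding_def by (auto intro: inj_compose linear_compose)

lemma sc_embedding_tangent:
  assumes "sc_embedding i E E'"
  shows "sc_embedding (map_prod i i) (tangent_space E) (tangent_space E')"
proof -
  have "linear (map_prod i i)"
    using assms by (auto intro!: linearI simp: sc_embedding_def linear_add linear_scale)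
  then show ?thesis
    using assms
    by (auto simp: sc_embedding_def tangent_space_def sc_sum_def sc_shift_def prod.inj_map
        map_prod_surj_on)
qed

lemma tangent_set_embedding:
  "sc_embedding i E E' \<Longrightarrow> tangent_set E' (i ` U) = map_prod i i ` tangent_set E U"
  unfolding tangent_set_def
  by (auto simp: sc_embedding_def image_Int[symmetric] inj_image_mem_iff)

lemma sc_map_seq_embedding:
  fixes i :: "(nat \<Rightarrow> 'a::real_vector) \<Rightarrow> nat \<Rightarrow> 'c::real_vector"
    and j :: "(nat \<Rightarrow> 'b::real_vector) \<Rightarrow> nat \<Rightarrow> 'd::real_vector"
  assumes "sc_embedding i E E'" "sc_embedding j F F'" "normed_levels E" "normed_levels F"
    "\<And>x. x \<in> U \<inter> level E 0 \<Longrightarrow> g (i x) = j (f x)"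
  shows "sc_map_seq k E' (i ` U) F' (j ` V) g \<longleftrightarrow> sc_map_seq k E U F V f"
  using assms
proof (induction k arbitrary: i j E E' F F' U V f g)
  case 0
  show ?case using sc0_embedding[OF 0(1-4), of U g f V] 0(5) by simp
next
  case (Suc k)
  note i = Suc.prems(1) and j = Suc.prems(2) and E = Suc.prems(3) and F = Suc.prems(4)
    and g = Suc.prems(5)
  note I = sc_embeddingD[OF i] and J = sc_embeddingD[OF j]
  have nest: "level E 1 \<subseteq> level E 0"
    using E by (auto simp: normed_levels_def)
  have sc0_eq: "sc0 E' (i ` U) F' (j ` V) g \<longleftrightarrow> sc0 E U F V f"
    by (rule sc0_embedding[OF i j E F]) (rule g)
  have dom: "i ` U \<inter> level E' 1 = i ` (U \<inter> level E 1)"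
    by (simp add: I(1,3) image_Int)
  have seq: "sc_embedding seq_pair T (transport seq_pair T)" for T :: "((nat \<Rightarrow> 'x::real_vector) \<times> _) sc_space"
    using bij_seq_pair linear_seq_pair by (intro sc_embedding_transport bij_is_inj)
  have lift: "sc_embedding (seq_pair \<circ> map_prod u u \<circ> inv seq_pair)
      (transport seq_pair (tangent_space G)) (transport seq_pair (tangent_space G'))"
    if "sc_embedding u G G'"
    for u :: "(nat \<Rightarrow> 'x::real_vector) \<Rightarrow> nat \<Rightarrow> 'y::real_vector" and G G'
  proof -
    have *: "sc_embedding (seq_pair \<circ> map_prod u u) (tangent_space G) (transport seq_pair (tangent_space G'))"
      by (intro sc_embedding_comp[OF sc_embedding_tangent[OF that] seq])
    have "linear (inv seq_pair :: (nat \<Rightarrow> 'x) \<Rightarrow> _)"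
    proof (rule linearI)
      have [simp]: "inv seq_pair s = p \<longleftrightarrow> s = seq_pair p" for s :: "nat \<Rightarrow> 'x" and p
        by (metis inv_seq_pair)
      show "inv seq_pair (s + t) = inv seq_pair s + inv seq_pair t"
        "inv seq_pair (c *\<^sub>R s) = c *\<^sub>R inv seq_pair s" for s t :: "nat \<Rightarrow> 'x" and c
        by (simp_all add: linear_add[OF linear_seq_pair] linear_scale[OF linear_seq_pair])
    qed
    then have "linear (seq_pair \<circ> map_prod u u \<circ> (inv seq_pair :: (nat \<Rightarrow> 'x) \<Rightarrow> _))"
      using * by (auto simp: sc_embedding_def intro: linear_compose)
    moreover have "inj (seq_pair \<circ> map_prod u u \<circ> (inv seq_pair :: (nat \<Rightarrow> 'x) \<Rightarrow> _))"
      using * bij_seq_pair by (auto simp: sc_embedding_def intro: inj_compose bij_is_inj bij_imp_bij_inv)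
    moreover have "inv seq_pair (seq_pair p) = p" for p :: "(nat \<Rightarrow> 'x) \<times> _"
      using bij_seq_pair by (simp add: bij_is_inj)
    ultimately show ?thesis
      using * by (auto simp: sc_embedding_def transport_def image_image)
  qed
  have setlift: "seq_pair ` tangent_set G' (u ` W) =
      (seq_pair \<circ> map_prod u u \<circ> inv seq_pair) ` seq_pair ` tangent_set G W"
    if "sc_embedding u G G'"
    for u :: "(nat \<Rightarrow> 'x::real_vector) \<Rightarrow> nat \<Rightarrow> 'y::real_vector" and G G' W
    using bij_seq_pair
    by (simp add: tangent_set_embedding[OF that] image_image bij_is_inj)
  have step: "sc_map_seq k
            (transport seq_pair (tangent_space E')) (seq_pair ` tangent_set E' (i ` U))
            (transport seq_pair (tangent_space F')) (seq_pair ` tangent_set F' (j ` V))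
            (seq_pair \<circ> tangent_map g D' \<circ> inv seq_pair) \<longleftrightarrow>
        sc_map_seq k
            (transport seq_pair (tangent_space E)) (seq_pair ` tangent_set E U)
            (transport seq_pair (tangent_space F)) (seq_pair ` tangent_set F V)
            (seq_pair \<circ> tangent_map f D \<circ> inv seq_pair)"
    if D: "\<And>x h. x \<in> U \<inter> level E 1 \<Longrightarrow> h \<in> level E 0 \<Longrightarrow> D' (i x) (i h) = j (D x h)" for D D'
    unfolding setlift[OF i] setlift[OF j]
  proof (rule Suc.IH[OF lift[OF i] lift[OF j]])
    show "normed_levels (transport seq_pair (tangent_space E))"
      "normed_levels (transport seq_pair (tangent_space F))"
      using normed_levels_embedding[OF seq] normed_levels_tangent_space E F by blast+
    fix s assume "s \<in> seq_pair ` tangent_set E U \<inter> level (transport seq_pair (tangent_space E)) 0"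
    then obtain x h where s: "s = seq_pair (x, h)" and x: "x \<in> U \<inter> level E 1" and h: "h \<in> level E 0"
      by (auto simp: tangent_set_def)
    have "g (i x) = j (f x)"
      using g x nest by blast
    then show "(seq_pair \<circ> tangent_map g D' \<circ> inv seq_pair) ((seq_pair \<circ> map_prod i i \<circ> inv seq_pair) s) =
         (seq_pair \<circ> map_prod j j \<circ> inv seq_pair) ((seq_pair \<circ> tangent_map f D \<circ> inv seq_pair) s)"
      using D[OF x h] bij_seq_pair by (simp add: s tangent_map_def bij_is_inj)
  qed
  have der: "(\<forall>x \<in> i ` U \<inter> level E' 1. has_sc_derivative E' (i ` U) F' g x (D' x)) \<longleftrightarrow>
             (\<forall>x \<in> U \<inter> level E 1. has_sc_derivative E U F f x (D x))"
    if f: "sc0 E U F V f"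
      and D: "\<And>x h. x \<in> U \<inter> level E 1 \<Longrightarrow> h \<in> level E 0 \<Longrightarrow> D' (i x) (i h) = j (D x h)" for D D'
    unfolding dom ball_simps
    by (rule ball_cong[OF refl]) (rule has_sc_derivative_embedding[OF i j E F _ f], simp_all add: g D)
  show ?case
  proof (intro iffI)
    assume "sc_map_seq (Suc k) E' (i ` U) F' (j ` V) g"
    then obtain D' where f: "sc0 E U F V f"
      and D': "\<forall>x \<in> i ` U \<inter> level E' 1. has_sc_derivative E' (i ` U) F' g x (D' x)"
      and k: "sc_map_seq k
            (transport seq_pair (tangent_space E')) (seq_pair ` tangent_set E' (i ` U))
            (transport seq_pair (tangent_space F')) (seq_pair ` tangent_set F' (j ` V))
            (seq_pair \<circ> tangent_map g D' \<circ> inv seq_pair)"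
      by (auto simp: sc0_eq)
    define D where "D x h = inv j (D' (i x) (i h))" for x h
    have D: "D' (i x) (i h) = j (D x h)" if "x \<in> U \<inter> level E 1" "h \<in> level E 0" for x h
    proof -
      have "D' (i x) (i h) \<in> level F' 0"
        using has_sc_derivative_level[of E' "i ` U" F' g "i x" "D' (i x)" "i h"] D' that
        unfolding dom I(3) by blast
      then show ?thesis by (auto simp: D_def J(3) J(1))
    qed
    show "sc_map_seq (Suc k) E U F V f"
      using f D' k der[of D' D, OF f D] step[of D' D, OF D] by auto
  next
    assume "sc_map_seq (Suc k) E U F V f"
    then obtain D where f: "sc0 E U F V f"
      and D: "\<forall>x \<in> U \<inter> level E 1. has_sc_derivative E U F f x (D x)"
      and k: "sc_map_seq k
            (transport seq_pair (tangent_space E)) (seq_pair ` tangent_set E U)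
            (transport seq_pair (tangent_space F)) (seq_pair ` tangent_set F V)
            (seq_pair \<circ> tangent_map f D \<circ> inv seq_pair)"
      by auto
    define D' where "D' y h = j (D (inv i y) (inv i h))" for y h
    have D': "D' (i x) (i h) = j (D x h)" if "x \<in> U \<inter> level E 1" "h \<in> level E 0" for x h
      by (simp add: D'_def I(1))
    show "sc_map_seq (Suc k) E' (i ` U) F' (j ` V) g"
      using f D k der[of D' D, OF f D'] step[of D' D, OF D'] by (auto simp: sc0_eq)
  qed
qed


lemma sc_map_0:
  assumes "normed_levels E" "normed_levels F"
  shows "sc_map 0 E U F V f \<longleftrightarrow> sc0 E U F V f"
proof -
  have emb: "sc_embedding seq_embed G (transport seq_embed G)" for G :: "'x::real_vector sc_space"
    using inj_seq_embed linear_seq_embed by (rule sc_embedding_transport)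
  show ?thesis
    unfolding sc_map_def using sc0_embedding[OF emb emb assms] by (simp add: inj_seq_embed)
qed

theorem sc_map_Suc:
  fixes E :: "'a::real_vector sc_space" and F :: "'b::real_vector sc_space"
  assumes E: "normed_levels E" and F: "normed_levels F"
  shows "sc_map (Suc k) E U F V f \<longleftrightarrow>
    sc0 E U F V f \<and>
    (\<exists>D. (\<forall>x \<in> U \<inter> level E 1. has_sc_derivative E U F f x (D x)) \<and>
         sc_map k (tangent_space E) (tangent_set E U) (tangent_space F) (tangent_set F V)
           (tangent_map f D))"
proof -
  have emb: "sc_embedding seq_embed G (transport seq_embed G)" for G :: "'x::real_vector sc_space"
    using inj_seq_embed linear_seq_embed by (rule sc_embedding_transport)
  have nest: "level E 1 \<subseteq> level E 0"
    using E by (auto simp: normed_levels_def)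
  let ?e = "seq_embed :: 'a \<Rightarrow> _" and ?e' = "seq_embed :: 'b \<Rightarrow> _"
  let ?E = "transport ?e E" and ?F = "transport ?e' F" and ?f = "?e' \<circ> f \<circ> inv ?e"
  have f: "?f (?e x) = ?e' (f x)" for x
    by (simp add: inj_seq_embed)
  have sc0_eq: "sc0 ?E (?e ` U) ?F (?e' ` V) ?f \<longleftrightarrow> sc0 E U F V f"
    by (rule sc0_embedding[OF emb emb E F]) (rule f)
  have dom: "?e ` U \<inter> level ?E 1 = ?e ` (U \<inter> level E 1)"
    by (simp add: inj_seq_embed image_Int transport_def)
  have inj_zp: "inj (\<lambda>s. seq_pair (fst \<circ> s, snd \<circ> s :: nat \<Rightarrow> 'x))"
  proof (rule injI)
    fix s t :: "nat \<Rightarrow> 'x \<times> 'x"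
    assume "seq_pair (fst \<circ> s, snd \<circ> s) = seq_pair (fst \<circ> t, snd \<circ> t)"
    then have "fst \<circ> s = fst \<circ> t" "snd \<circ> s = snd \<circ> t"
      by simp_all
    then show "s = t" by (auto simp: fun_eq_iff prod_eq_iff)
  qed
  have lin_zp: "linear (\<lambda>s. seq_pair (fst \<circ> s, snd \<circ> s :: nat \<Rightarrow> 'x::real_vector))"
    by (rule linearI) (auto simp: seq_pair_def fun_eq_iff scaleR_fun_def)
  have zp_embed: "seq_pair (fst \<circ> seq_embed p, snd \<circ> seq_embed p) = seq_pair (map_prod seq_embed seq_embed p)"
    for p :: "'x::real_vector \<times> 'x"
    by (cases p) (auto simp: seq_pair_def seq_embed_def fun_eq_iff)
  have seq: "sc_embedding seq_pair T (transport seq_pair T)" for T :: "((nat \<Rightarrow> 'x::real_vector) \<times> _) sc_space"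
    using bij_seq_pair linear_seq_pair by (intro sc_embedding_transport bij_is_inj)
  have zp: "sc_embedding (\<lambda>s. seq_pair (fst \<circ> s, snd \<circ> s))
      (transport seq_embed (tangent_space G)) (transport seq_pair (tangent_space (transport seq_embed G)))"
    for G :: "'x::real_vector sc_space"
  proof -
    have *: "sc_embedding (seq_pair \<circ> map_prod seq_embed seq_embed) (tangent_space G)
        (transport seq_pair (tangent_space (transport seq_embed G)))"
      by (intro sc_embedding_comp[OF sc_embedding_tangent[OF emb] seq])
    show ?thesis
      unfolding sc_embedding_def
    proof (intro conjI allI ballI inj_zp lin_zp)
      fix m
      show "level (transport seq_pair (tangent_space (transport seq_embed G))) m =
          (\<lambda>s. seq_pair (fst \<circ> s, snd \<circ> s)) ` level (transport seq_embed (tangent_space G)) m"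
        using * by (simp add: sc_embedding_def transport_def[of seq_embed "tangent_space G"] image_image zp_embed)
      fix s assume "s \<in> level (transport seq_embed (tangent_space G)) m"
      then obtain p where p: "p \<in> level (tangent_space G) m" "s = seq_embed p"
        by (auto simp: transport_def)
      have "lnorm (transport seq_pair (tangent_space (transport seq_embed G))) m
              ((seq_pair \<circ> map_prod seq_embed seq_embed) p) = lnorm (tangent_space G) m p"
        using * p(1) unfolding sc_embedding_def by blast
      also have "\<dots> = lnorm (transport seq_embed (tangent_space G)) m s"
        using sc_embeddingD(4)[OF emb p(1)] p(2) by simp
      finally show "lnorm (transport seq_pair (tangent_space (transport seq_embed G))) m
          (seq_pair (fst \<circ> s, snd \<circ> s)) = lnorm (transport seq_embed (tangent_space G)) m s"
        using p(2) by (simp add: zp_embed)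
    qed
  qed
  have zpset: "seq_pair ` tangent_set (transport seq_embed G) (seq_embed ` W) =
      (\<lambda>s. seq_pair (fst \<circ> s, snd \<circ> s)) ` seq_embed ` tangent_set G W"
    for G :: "'x::real_vector sc_space" and W
    by (simp add: tangent_set_embedding[OF emb] image_image zp_embed)
  have step: "sc_map_seq k
            (transport seq_pair (tangent_space ?E)) (seq_pair ` tangent_set ?E (?e ` U))
            (transport seq_pair (tangent_space ?F)) (seq_pair ` tangent_set ?F (?e' ` V))
            (seq_pair \<circ> tangent_map ?f D' \<circ> inv seq_pair) \<longleftrightarrow>
        sc_map k (tangent_space E) (tangent_set E U) (tangent_space F) (tangent_set F V) (tangent_map f D)"
    if D: "\<And>x h. x \<in> U \<inter> level E 1 \<Longrightarrow> h \<in> level E 0 \<Longrightarrow> D' (?e x) (?e h) = ?e' (D x h)" for D D'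
    unfolding sc_map_def zpset
  proof (rule sc_map_seq_embedding[OF zp zp])
    show "normed_levels (transport seq_embed (tangent_space E))"
      "normed_levels (transport seq_embed (tangent_space F))"
      using normed_levels_embedding[OF emb] normed_levels_tangent_space E F by blast+
    fix s assume "s \<in> seq_embed ` tangent_set E U \<inter> level (transport seq_embed (tangent_space E)) 0"
    then obtain x h where s: "s = seq_embed (x, h)" and x: "x \<in> U \<inter> level E 1" and h: "h \<in> level E 0"
      by (auto simp: tangent_set_def)
    have [simp]: "inv seq_pair (seq_pair p) = p" for p :: "(nat \<Rightarrow> 'a) \<times> _"
      using bij_seq_pair by (simp add: bij_is_inj)
    show "(seq_pair \<circ> tangent_map ?f D' \<circ> inv seq_pair) (seq_pair (fst \<circ> s, snd \<circ> s)) =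
         (\<lambda>s. seq_pair (fst \<circ> s, snd \<circ> s)) ((seq_embed \<circ> tangent_map f D \<circ> inv seq_embed) s)"
      using D[OF x h] by (simp add: s tangent_map_def zp_embed inj_seq_embed)
  qed
  have der: "(\<forall>x \<in> ?e ` U \<inter> level ?E 1. has_sc_derivative ?E (?e ` U) ?F ?f x (D' x)) \<longleftrightarrow>
             (\<forall>x \<in> U \<inter> level E 1. has_sc_derivative E U F f x (D x))"
    if fU: "sc0 E U F V f"
      and D: "\<And>x h. x \<in> U \<inter> level E 1 \<Longrightarrow> h \<in> level E 0 \<Longrightarrow> D' (?e x) (?e h) = ?e' (D x h)" for D D'
    unfolding dom ball_simps
    by (rule ball_cong[OF refl]) (rule has_sc_derivative_embedding[OF emb emb E F _ fU], simp_all only: f D)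
  show ?thesis
  proof (intro iffI)
    assume "sc_map (Suc k) E U F V f"
    then obtain D' where fU: "sc0 E U F V f"
      and D': "\<forall>x \<in> ?e ` U \<inter> level ?E 1. has_sc_derivative ?E (?e ` U) ?F ?f x (D' x)"
      and k: "sc_map_seq k
            (transport seq_pair (tangent_space ?E)) (seq_pair ` tangent_set ?E (?e ` U))
            (transport seq_pair (tangent_space ?F)) (seq_pair ` tangent_set ?F (?e' ` V))
            (seq_pair \<circ> tangent_map ?f D' \<circ> inv seq_pair)"
      by (auto simp: sc_map_def sc0_eq)
    define D where "D x h = inv ?e' (D' (?e x) (?e h))" for x h
    have D: "D' (?e x) (?e h) = ?e' (D x h)" if "x \<in> U \<inter> level E 1" "h \<in> level E 0" for x h
    proof -
      have "D' (?e x) (?e h) \<in> level ?F 0"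
        using has_sc_derivative_level[of ?E "?e ` U" ?F ?f "?e x" "D' (?e x)" "?e h"] D' that
        unfolding dom by (auto simp: transport_def)
      then show ?thesis by (auto simp: D_def transport_def inj_seq_embed)
    qed
    show "sc0 E U F V f \<and>
      (\<exists>D. (\<forall>x \<in> U \<inter> level E 1. has_sc_derivative E U F f x (D x)) \<and>
         sc_map k (tangent_space E) (tangent_set E U) (tangent_space F) (tangent_set F V)
           (tangent_map f D))"
      using fU D' k der[of D' D, OF fU D] step[of D' D, OF D] by blast
  next
    assume "sc0 E U F V f \<and>
      (\<exists>D. (\<forall>x \<in> U \<inter> level E 1. has_sc_derivative E U F f x (D x)) \<and>
         sc_map k (tangent_space E) (tangent_set E U) (tangent_space F) (tangent_set F V)
           (tangent_map f D))"
    then obtain D where fU: "sc0 E U F V f"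
      and D: "\<forall>x \<in> U \<inter> level E 1. has_sc_derivative E U F f x (D x)"
      and k: "sc_map k (tangent_space E) (tangent_set E U) (tangent_space F) (tangent_set F V)
           (tangent_map f D)"
      by blast
    define D' where "D' y h = ?e' (D (inv ?e y) (inv ?e h))" for y h
    have D': "D' (?e x) (?e h) = ?e' (D x h)" if "x \<in> U \<inter> level E 1" "h \<in> level E 0" for x h
      by (simp add: D'_def inj_seq_embed)
    have "\<forall>x \<in> ?e ` U \<inter> level ?E 1. has_sc_derivative ?E (?e ` U) ?F ?f x (D' x)"
      using der[of D' D, OF fU D'] D by blast
    moreover have "sc_map_seq k
            (transport seq_pair (tangent_space ?E)) (seq_pair ` tangent_set ?E (?e ` U))
            (transport seq_pair (tangent_space ?F)) (seq_pair ` tangent_set ?F (?e' ` V))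
            (seq_pair \<circ> tangent_map ?f D' \<circ> inv seq_pair)"
      using step[of D' D, OF D'] k by blast
    ultimately show "sc_map (Suc k) E U F V f"
      unfolding sc_map_def sc_map_seq.simps sc0_eq using fU by blast
  qed
qed

end

theory Submission
  imports Defs
begin

text \<open>In a chart, a partial quadrant \<open>C\<close> is cut out of \<open>E\<^sub>0\<close> by the inequalities \<open>0 \<le> l i x\<close> for linearly
  independent bounded functionals \<open>l 0, \<dots>, l (k - 1)\<close>, and the degeneration index counts the
  coordinates that are active at \<open>x\<close>, i.e. those with \<open>l i x = 0\<close>. Let \<open>x\<close> be a smooth point of the first
  model and \<open>y = f x\<close>. If all active coordinates at \<open>x\<close> vanish on \<open>h\<close>, then the segment \<open>x + t h\<close> stays in
  \<open>C\<close> for small \<open>t\<close> of either sign, so an active coordinate \<open>l' j\<close> at \<open>y\<close>, evaluated along the image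
  of this segment, is nonnegative and vanishes at \<open>t = 0\<close>. Hence \<open>l' j\<close> vanishes on the image of \<open>h\<close>
  under the derivative \<open>D\<close> of \<open>f \<circ> r\<close> at \<open>x\<close>. So the functionals \<open>l' j \<circ> D\<close> lie in the span of the active
  \<open>l i\<close>, and if they are linearly independent then there are at most as many of them
  (\<open>card_le_of_common_kernel\<close>): the degeneration index of \<open>y\<close> is at most that of \<open>x\<close>.

  Two facts give the independence. First, the kernel \<open>K\<close> of \<open>id - D\<rho>(y)\<close>, for a retraction \<open>\<rho>\<close> onto the
  second model, has a complement inside the quadrant. A linear subspace inside a quadrant is
  annihilated by all coordinates, so the coordinates are as independent on \<open>K\<close> as on the whole space,
  and by density on the smooth points of \<open>K\<close>, even on those with positive coordinates
  (\<open>active_coordinates_independent_on_summand\<close>). Second, \<open>D\<close> reaches these points. For such an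
  \<open>h\<close> the segment \<open>y + t h\<close> stays in the second quadrant for small \<open>t \<ge> 0\<close>; applying \<open>\<rho>\<close>, the inverse
  of \<open>f\<close> and then \<open>f\<close> again to it returns the curve \<open>\<rho> (y + t h)\<close>, whose initial velocity is \<open>h\<close>, so the
  chain rule exhibits \<open>h\<close> as a value of \<open>D\<close> (\<open>derivative_right_inverse\<close>).

  The chain rule is the delicate point, because sc-differentiability measures the increments in \<open>E\<^sub>1\<close>
  but the remainder only in \<open>F\<^sub>0\<close>. It is needed only along curves that are continuously
  differentiable on all levels. The image of such a curve is differentiable in \<open>F\<^sub>0\<close>, with a
  derivative that is continuous on every level. By the mean value theorem its difference quotients are
  \<open>F\<^sub>0\<close>-limits of elements of small balls of level \<open>m + 1\<close>, and these balls are precompact in level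
  \<open>m\<close>, so the differentiability holds on level \<open>m\<close> too (\<open>curve_derivative_level_gain\<close>).

  Exchanging the roles of \<open>f\<close> and its inverse gives equality of the indices at smooth points. An arbitrary
  point \<open>x\<close> is a limit of smooth points with the same index. As the index is upper semicontinuous,
  the index of \<open>f x\<close> is at least that of \<open>x\<close>, and symmetry gives equality again. The same kernel argument, applied to
  two charts of one quadrant, shows that the index is independent of the chart.\<close>

section \<open>Linear functionals with a common kernel\<close>

lemma linear_on_set_diff:
  assumes "subspace V" "linear_on_set V T" "x \<in> V" "y \<in> V"
  shows "T (x - y) = T x - T y"
proof -
  have "T (x + (-1) *\<^sub>R y) = T x + (-1) *\<^sub>R T y"
    using assms subspace_scale[of V y "-1"] unfolding linear_on_set_def by metis
  then show ?thesis by simp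
qed

lemma linear_on_set_subset: "linear_on_set V T \<Longrightarrow> W \<subseteq> V \<Longrightarrow> linear_on_set W T"
  unfolding linear_on_set_def by blast

lemma functional_in_span:
  fixes l :: "'i \<Rightarrow> 'a::real_vector \<Rightarrow> real" and m :: "'a \<Rightarrow> real"
  assumes "finite I" and "subspace V" and "\<And>i. i \<in> I \<Longrightarrow> linear_on_set V (l i)" and "linear_on_set V m"
    and "\<And>v. v \<in> V \<Longrightarrow> (\<And>i. i \<in> I \<Longrightarrow> l i v = 0) \<Longrightarrow> m v = 0"
  shows "\<exists>c. \<forall>v\<in>V. m v = (\<Sum>i\<in>I. c i * l i v)"
  using assms
proof (induction I arbitrary: V rule: finite_induct)
  case empty
  then show ?case by simp
next
  case (insert i I)
  note V = insert.prems(1) and m = insert.prems(3)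
  have li: "linear_on_set V (l i)" and lI: "\<And>j. j \<in> I \<Longrightarrow> linear_on_set V (l j)"
    using insert.prems(2) by auto
  define V' where "V' = {v\<in>V. l i v = 0}"
  have sub: "V' \<subseteq> V" by (auto simp: V'_def)
  have "l i 0 = 0"
    using li subspace_0[OF V] unfolding linear_on_set_def by (metis mult_zero_left real_scaleR_def scale_zero_left)
  then have V': "subspace V'"
    using V li by (auto simp: V'_def linear_on_set_def subspace_def)
  have lin': "linear_on_set V' n" if "linear_on_set V n" for n :: "'a \<Rightarrow> real"
    using that sub by (rule linear_on_set_subset)
  have "\<exists>c. \<forall>v\<in>V'. m v = (\<Sum>j\<in>I. c j * l j v)"
  proof (rule insert.IH[OF V'])
    show "m v = 0" if "v \<in> V'" "\<And>j. j \<in> I \<Longrightarrow> l j v = 0" for v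
      using that insert.prems(4)[of v] unfolding V'_def by blast
  qed (use lin' lI m in auto)
  then obtain c where c: "\<And>v. v \<in> V' \<Longrightarrow> m v = (\<Sum>j\<in>I. c j * l j v)" by blast
  show ?case
  proof (cases "\<exists>w\<in>V. l i w \<noteq> 0")
    case False
    then have "V' = V" by (auto simp: V'_def)
    then have "\<forall>v\<in>V. m v = (\<Sum>j\<in>insert i I. (c(i := 0)) j * l j v)"
      using c insert.hyps by (auto intro!: sum.cong)
    then show ?thesis by blast
  next
    case True
    then obtain w where w: "w \<in> V" "l i w \<noteq> 0" by blast
    define n where "n v = m v - (\<Sum>j\<in>I. c j * l j v)" for v
    have n: "n (x - r *\<^sub>R y) = n x - r * n y" if "x \<in> V" "y \<in> V" for x y r
    proof -
      have lin: "f (x - r *\<^sub>R y) = f x - r * f y" if f: "linear_on_set V f" for f :: "'a \<Rightarrow> real"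
        using linear_on_set_diff[OF V f \<open>x \<in> V\<close> subspace_scale[OF V \<open>y \<in> V\<close>]] f \<open>y \<in> V\<close>
        by (simp add: linear_on_set_def)
      have "(\<Sum>j\<in>I. c j * l j (x - r *\<^sub>R y)) = (\<Sum>j\<in>I. c j * l j x) - r * (\<Sum>j\<in>I. c j * l j y)"
        by (simp add: lin lI sum_subtractf sum_distrib_left algebra_simps)
      then show ?thesis by (simp add: n_def lin[OF m] algebra_simps)
    qed
    \<comment> \<open>The remainder \<open>n\<close> vanishes on the kernel of \<open>l i\<close>, hence is a multiple of \<open>l i\<close>.\<close>
    have "m v = (\<Sum>j\<in>insert i I. (c(i := n w / l i w)) j * l j v)" if v: "v \<in> V" for v
    proof -
      let ?r = "l i v / l i w"
      have "l i (v - ?r *\<^sub>R w) = 0"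
        using linear_on_set_diff[OF V li v subspace_scale[OF V w(1)]] li w
        by (simp add: linear_on_set_def)
      then have "v - ?r *\<^sub>R w \<in> V'"
        using v w V by (simp add: V'_def subspace_diff subspace_scale)
      then have "n (v - ?r *\<^sub>R w) = 0" using c by (simp add: n_def)
      then have "n v = n w / l i w * l i v" using n[OF v w(1)] by simp
      moreover have "(\<Sum>j\<in>I. (c(i := n w / l i w)) j * l j v) = (\<Sum>j\<in>I. c j * l j v)"
        using insert.hyps by (auto intro!: sum.cong)
      ultimately show ?thesis
        using insert.hyps by (simp add: n_def)
    qed
    then show ?thesis by blast
  qed
qed

text \<open>Extended by zero outside \<open>V\<close>, the functionals become vectors of a function space. There the kernel
  condition says that the \<open>m j\<close> lie in the span of the \<open>l i\<close>, and the bound on the size of independent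
  sets applies.\<close>

lemma card_le_of_common_kernel:
  fixes l :: "'i \<Rightarrow> 'a::real_vector \<Rightarrow> real" and m :: "'j \<Rightarrow> 'a \<Rightarrow> real"
  assumes I: "finite I" and J: "finite J" and V: "subspace V"
    and l: "\<And>i. i \<in> I \<Longrightarrow> linear_on_set V (l i)" and m: "\<And>j. j \<in> J \<Longrightarrow> linear_on_set V (m j)"
    and ker: "\<And>v j. v \<in> V \<Longrightarrow> (\<And>i. i \<in> I \<Longrightarrow> l i v = 0) \<Longrightarrow> j \<in> J \<Longrightarrow> m j v = 0"
    and indep: "\<And>c. (\<And>v. v \<in> V \<Longrightarrow> (\<Sum>j\<in>J. c j * m j v) = 0) \<Longrightarrow> \<forall>j\<in>J. c j = 0"
  shows "card J \<le> card I"
proof -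
  define R where "R f = (\<lambda>v. if v \<in> V then f v else (0::real))" for f
  have sum_apply: "(\<Sum>a\<in>A. g a) v = (\<Sum>a\<in>A. g a v)" for A :: "'k set" and g :: "'k \<Rightarrow> 'a \<Rightarrow> real" and v
    by (induction A rule: infinite_finite_induct) auto
  let ?L = "(\<lambda>i. R (l i)) ` I" and ?M = "(\<lambda>j. R (m j)) ` J"
  have "R (m j) \<in> span ?L" if j: "j \<in> J" for j
  proof -
    have "\<exists>c. \<forall>v\<in>V. m j v = (\<Sum>i\<in>I. c i * l i v)"
      by (rule functional_in_span[OF I V l m[OF j]]) (use ker j in auto)
    then obtain c where c: "\<And>v. v \<in> V \<Longrightarrow> m j v = (\<Sum>i\<in>I. c i * l i v)" by blast
    have "R (m j) = (\<Sum>i\<in>I. c i *\<^sub>R R (l i))"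
      by (rule ext) (simp add: sum_apply R_def scaleR_fun_def c)
    also have "\<dots> \<in> span ?L"
      by (rule span_sum, rule span_scale, rule span_base) blast
    finally show ?thesis .
  qed
  then have sp: "?M \<subseteq> span ?L" by blast
  have inj: "inj_on (\<lambda>j. R (m j)) J"
  proof (rule inj_onI, rule ccontr)
    fix i j assume ij: "i \<in> J" "j \<in> J" and eq: "R (m i) = R (m j)" and ne: "i \<noteq> j"
    define c where "c p = (if p = i then 1 else 0) - (if p = j then 1 else (0::real))" for p
    have "(\<Sum>p\<in>J. c p * m p v) = 0" if "v \<in> V" for v
      using fun_cong[OF eq, of v] that ij J
      by (simp add: c_def left_diff_distrib sum_subtractf R_def if_distrib[of "\<lambda>x. x * _"] cong: if_cong)
    then have "c i = 0" using indep ij by blast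
    then show False using ne by (simp add: c_def)
  qed
  have "independent ?M"
  proof (rule ccontr)
    assume "\<not> independent ?M"
    then obtain u where u: "\<exists>f\<in>?M. u f \<noteq> 0" "(\<Sum>f\<in>?M. u f *\<^sub>R f) = 0"
      using J by (auto simp: dependent_finite)
    have "(\<Sum>j\<in>J. u (R (m j)) * m j v) = 0" if "v \<in> V" for v
    proof -
      have "(\<Sum>j\<in>J. u (R (m j)) *\<^sub>R R (m j)) = 0"
        using u(2) by (simp add: sum.reindex[OF inj] comp_def)
      from fun_cong[OF this, of v] show ?thesis
        using that by (simp add: sum_apply scaleR_fun_def R_def)
    qed
    then have "\<forall>j\<in>J. u (R (m j)) = 0" by (rule indep)
    then show False using u(1) by auto
  qed
  then have "card ?M \<le> card ?L"
    using independent_span_bound[of ?L ?M] sp I by blast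
  also have "card ?M = card J" using inj by (rule card_image)
  also have "card ?L \<le> card I" using I by (rule card_image_le)
  finally show ?thesis .
qed

section \<open>Norms and compact inclusions of levels\<close>

lemma
  assumes "normed_levels E"
  shows subspace_level: "subspace (level E m)"
    and lnorm_nonneg: "x \<in> level E m \<Longrightarrow> 0 \<le> lnorm E m x"
    and lnorm_eq_0: "x \<in> level E m \<Longrightarrow> lnorm E m x = 0 \<longleftrightarrow> x = 0"
    and lnorm_scaleR: "x \<in> level E m \<Longrightarrow> lnorm E m (c *\<^sub>R x) = \<bar>c\<bar> * lnorm E m x"
    and lnorm_triangle: "x \<in> level E m \<Longrightarrow> y \<in> level E m \<Longrightarrow> lnorm E m (x + y) \<le> lnorm E m x + lnorm E m y"
    and level_Suc_subset: "level E (Suc m) \<subseteq> level E m"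
  using assms by (auto simp: normed_levels_def norm_on_def)

lemma lnorm_0: "normed_levels E \<Longrightarrow> lnorm E m 0 = 0"
  by (simp add: lnorm_eq_0 subspace_level subspace_0)

lemma lnorm_minus_commute:
  assumes "normed_levels E" "x \<in> level E m" "y \<in> level E m"
  shows "lnorm E m (x - y) = lnorm E m (y - x)"
proof -
  have "y - x \<in> level E m" using assms by (simp add: subspace_level subspace_diff)
  from lnorm_scaleR[OF assms(1) this, of "-1"] show ?thesis by simp
qed

lemma level_antimono: "normed_levels E \<Longrightarrow> m \<le> n \<Longrightarrow> level E n \<subseteq> level E m"
  by (rule lift_Suc_antimono_le[of "level E"]) (simp_all add: level_Suc_subset)

lemma sc_Banach_normed: "sc_Banach E \<Longrightarrow> normed_levels E"
  by (simp add: sc_Banach_def)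

lemma unit_ball_bounded:
  assumes "sc_Banach E"
  shows "\<exists>c>0. \<forall>x\<in>level_top E m closure_of {x \<in> level E (Suc m). lnorm E (Suc m) x \<le> 1}.
    x \<in> level E m \<and> lnorm E m x \<le> c"
proof -
  let ?K = "level_top E m closure_of {x \<in> level E (Suc m). lnorm E (Suc m) x \<le> 1}"
  have n: "normed_levels E" using assms by (rule sc_Banach_normed)
  interpret Metric_space "level E m" "level_dist E m" using n by (rule Metric_space_level)
  have "mbounded ?K"
    using assms compactin_imp_mbounded by (simp add: sc_Banach_def level_top_def)
  then obtain a B where B: "B > 0" "?K \<subseteq> mcball a B" unfolding mbounded_pos by blast
  have "lnorm E m x \<le> \<bar>lnorm E m a\<bar> + B" "x \<in> level E m" if "x \<in> ?K" for x
  proof -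
    have x: "x \<in> level E m" "a \<in> level E m" "level_dist E m a x \<le> B" using B(2) that by auto
    have "lnorm E m (a + (x - a)) \<le> lnorm E m a + lnorm E m (x - a)"
      using x n by (intro lnorm_triangle) (auto intro: subspace_diff subspace_level)
    then show "lnorm E m x \<le> \<bar>lnorm E m a\<bar> + B"
      using x lnorm_minus_commute[OF n x(1,2)] by (simp add: level_dist_def)
    show "x \<in> level E m" by fact
  qed
  then show ?thesis using B(1) by (intro exI[of _ "\<bar>lnorm E m a\<bar> + B"]) auto
qed

lemma inclusion_bounded:
  assumes "sc_Banach E"
  shows "\<exists>c>0. \<forall>x\<in>level E m. lnorm E 0 x \<le> c * lnorm E m x"
proof (induction m)
  case 0
  then show ?case by (auto intro!: exI[of _ 1])
next
  case (Suc m)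
  note n = sc_Banach_normed[OF assms]
  obtain c where c: "c > 0" "\<And>x. x \<in> level E m \<Longrightarrow> lnorm E 0 x \<le> c * lnorm E m x"
    using Suc by blast
  let ?B = "{x \<in> level E (Suc m). lnorm E (Suc m) x \<le> 1}"
  obtain d where d: "d > 0" "\<And>x. x \<in> level_top E m closure_of ?B \<Longrightarrow> lnorm E m x \<le> d"
    using unit_ball_bounded[OF assms, of m] by blast
  have "?B \<subseteq> level_top E m closure_of ?B"
    using level_Suc_subset[OF n, of m] n by (intro closure_of_subset) auto
  then have unit: "lnorm E m x \<le> d" if "x \<in> ?B" for x
    using d that by blast
  have "lnorm E 0 x \<le> c * d * lnorm E (Suc m) x" if x: "x \<in> level E (Suc m)" for x
  proof (cases "x = 0")
    case True
    then show ?thesis by (simp add: lnorm_0[OF n])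
  next
    case False
    define t where "t = lnorm E (Suc m) x"
    have t: "t > 0"
      using x False lnorm_eq_0[OF n x] lnorm_nonneg[OF n x] by (simp add: t_def)
    have xm: "x \<in> level E m" using x level_Suc_subset[OF n] by blast
    have "inverse t *\<^sub>R x \<in> ?B"
      using x t subspace_scale[OF subspace_level[OF n] x] by (simp add: lnorm_scaleR[OF n] t_def)
    from unit[OF this] have "lnorm E m x \<le> d * t"
      using t by (simp add: lnorm_scaleR[OF n xm] field_simps)
    then have "c * lnorm E m x \<le> c * (d * t)" using c(1) by simp
    then show ?thesis using c(2)[OF xm] by (simp add: t_def mult.assoc)
  qed
  then show ?case using c(1) d(1) by (intro exI[of _ "c * d"]) auto
qed

text \<open>This is how compactness of the inclusions enters. The unit ball of level \<open>m + 1\<close> is precompact in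
  level \<open>m\<close>, so a sequence in it subconverges there, and convergence in level \<open>0\<close> identifies the limit.\<close>

lemma unit_ball_limit_bounded:
  assumes "sc_Banach E"
  shows "\<exists>c>0. \<forall>v\<in>level E 0.
    (\<forall>e>0. \<exists>b\<in>level E (Suc m). lnorm E (Suc m) b \<le> 1 \<and> lnorm E 0 (v - b) \<le> e) \<longrightarrow>
    v \<in> level E m \<and> lnorm E m v \<le> c"
proof -
  note n = sc_Banach_normed[OF assms]
  interpret Metric_space "level E m" "level_dist E m" using n by (rule Metric_space_level)
  let ?B = "{x \<in> level E (Suc m). lnorm E (Suc m) x \<le> 1}"
  let ?K = "level_top E m closure_of ?B"
  obtain c where c: "c > 0" "\<And>x. x \<in> ?K \<Longrightarrow> x \<in> level E m \<and> lnorm E m x \<le> c"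
    using unit_ball_bounded[OF assms, of m] by blast
  obtain d where d: "d > 0" "\<And>x. x \<in> level E m \<Longrightarrow> lnorm E 0 x \<le> d * lnorm E m x"
    using inclusion_bounded[OF assms, of m] by blast
  have "v \<in> ?K"
    if v: "v \<in> level E 0" and approx: "\<And>e. e > 0 \<Longrightarrow> \<exists>b\<in>?B. lnorm E 0 (v - b) \<le> e" for v
  proof -
    obtain b where b: "\<And>k. b k \<in> ?B" "\<And>k::nat. lnorm E 0 (v - b k) \<le> 1 / Suc k"
      using approx[of "1 / Suc _"] by (metis of_nat_0_less_iff zero_less_Suc zero_less_divide_1_iff)
    have "?B \<subseteq> ?K"
      using level_Suc_subset[OF n, of m] n by (intro closure_of_subset) auto
    then have "range b \<subseteq> ?K" using b(1) by auto
    moreover have "compactin mtopology ?K"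
      using assms by (simp add: sc_Banach_def level_top_def)
    ultimately obtain w r where w: "w \<in> ?K" and r: "strict_mono r"
      and lim: "limitin mtopology (b \<circ> r) w sequentially"
      unfolding compactin_sequentially by blast
    have lev: "w \<in> level E m" "b k \<in> level E m" for k
      using w c(2) b(1) level_Suc_subset[OF n] by auto
    have lev0: "w \<in> level E 0" "b k \<in> level E 0" for k
      using lev level_antimono[OF n, of 0 m] by auto
    have tm: "(\<lambda>k. lnorm E m (b (r k) - w)) \<longlonglongrightarrow> 0"
      using lim lev unfolding limitin_metric_dist_null by (simp add: level_dist_def comp_def)
    have "lnorm E 0 (v - w) \<le> 1 / Suc k + d * lnorm E m (b (r k) - w)" for k
    proof -
      have "lnorm E 0 ((v - b (r k)) + (b (r k) - w)) \<le> lnorm E 0 (v - b (r k)) + lnorm E 0 (b (r k) - w)"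
        using v lev0 by (intro lnorm_triangle[OF n] subspace_diff subspace_level[OF n])
      moreover have "lnorm E 0 (b (r k) - w) \<le> d * lnorm E m (b (r k) - w)"
        using lev by (intro d(2) subspace_diff subspace_level[OF n])
      moreover have "1 / real (Suc (r k)) \<le> 1 / Suc k"
        using seq_suble[OF r, of k] by (simp add: frac_le)
      ultimately show ?thesis using b(2)[of "r k"] by simp
    qed
    moreover have "(\<lambda>k. 1 / Suc k + d * lnorm E m (b (r k) - w)) \<longlonglongrightarrow> 0 + d * 0"
      by (intro tendsto_intros tm LIMSEQ_Suc[OF lim_1_over_n])
    ultimately have "lnorm E 0 (v - w) \<le> 0"
      using LIMSEQ_le_const[of _ 0] by force
    then have "v = w"
      using lnorm_nonneg[OF n] lnorm_eq_0[OF n] v lev0 subspace_diff[OF subspace_level[OF n]]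
      by (metis antisym right_minus_eq)
    then show ?thesis using w by simp
  qed
  then show ?thesis using c by (intro exI[of _ c]) (simp, blast)
qed

section \<open>Differentiable curves\<close>

text \<open>The parameter is confined to \<open>X\<close>, so that the derivative is one-sided at the ends of an interval.\<close>

definition curve_derivative ::
  "'a::real_vector sc_space \<Rightarrow> nat \<Rightarrow> real set \<Rightarrow> (real \<Rightarrow> 'a) \<Rightarrow> 'a \<Rightarrow> real \<Rightarrow> bool" where
  "curve_derivative E m X \<gamma> v s \<longleftrightarrow>
     (\<forall>e>0. \<exists>d>0. \<forall>t\<in>X. \<bar>t - s\<bar> < d \<longrightarrow>
        lnorm E m (\<gamma> t - \<gamma> s - (t - s) *\<^sub>R v) \<le> e * \<bar>t - s\<bar>)"

lemma curve_derivative_subset: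
  "curve_derivative E m X \<gamma> v s \<Longrightarrow> Y \<subseteq> X \<Longrightarrow> curve_derivative E m Y \<gamma> v s"
  unfolding curve_derivative_def by (meson subsetD)

lemma curve_derivative_unique:
  assumes n: "normed_levels E" and \<tau>: "\<tau> > 0"
    and v: "v \<in> level E m" and w: "w \<in> level E m" and \<gamma>: "\<And>s. s \<in> {0..\<tau>} \<Longrightarrow> \<gamma> s \<in> level E m"
    and dv: "curve_derivative E m {0..\<tau>} \<gamma> v 0" and dw: "curve_derivative E m {0..\<tau>} \<gamma> w 0"
  shows "v = w"
proof -
  note sub = subspace_level[OF n]
  have "lnorm E m (v - w) \<le> 0 + e" if e: "e > 0" for e
  proof -
    obtain d1 where d1: "d1 > 0"
      "\<And>t. t \<in> {0..\<tau>} \<Longrightarrow> \<bar>t - 0\<bar> < d1 \<Longrightarrow> lnorm E m (\<gamma> t - \<gamma> 0 - (t - 0) *\<^sub>R v) \<le> e / 2 * \<bar>t - 0\<bar>"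
      using dv e unfolding curve_derivative_def by (meson half_gt_zero)
    obtain d2 where d2: "d2 > 0"
      "\<And>t. t \<in> {0..\<tau>} \<Longrightarrow> \<bar>t - 0\<bar> < d2 \<Longrightarrow> lnorm E m (\<gamma> t - \<gamma> 0 - (t - 0) *\<^sub>R w) \<le> e / 2 * \<bar>t - 0\<bar>"
      using dw e unfolding curve_derivative_def by (meson half_gt_zero)
    define t where "t = min \<tau> (min (d1 / 2) (d2 / 2))"
    have t: "t > 0" "t \<in> {0..\<tau>}" "t < d1" "t < d2"
      using \<tau> d1(1) d2(1) by (auto simp: t_def min_def)
    let ?a = "\<gamma> t - \<gamma> 0 - t *\<^sub>R v" and ?b = "\<gamma> t - \<gamma> 0 - t *\<^sub>R w"
    have lev: "?a \<in> level E m" "?b \<in> level E m"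
      using t \<gamma> \<tau> v w by (auto intro!: subspace_diff[OF sub] subspace_scale[OF sub])
    have "t * lnorm E m (v - w) = lnorm E m (t *\<^sub>R (v - w))"
      using t v w by (simp add: lnorm_scaleR[OF n] subspace_diff[OF sub])
    also have "t *\<^sub>R (v - w) = ?b + (-1) *\<^sub>R ?a" by (simp add: scaleR_diff_right)
    also have "lnorm E m \<dots> \<le> lnorm E m ?b + lnorm E m ((-1) *\<^sub>R ?a)"
      by (intro lnorm_triangle[OF n] lev subspace_scale[OF sub])
    also have "\<dots> = lnorm E m ?b + lnorm E m ?a"
      using lnorm_scaleR[OF n lev(1), of "-1"] by simp
    also have "\<dots> \<le> t * e"
      using d1(2)[OF t(2)] d2(2)[OF t(2)] t by (simp add: field_simps)
    finally show ?thesis using t(1) by simp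
  qed
  then have "lnorm E m (v - w) \<le> 0" by (rule field_le_epsilon)
  then show ?thesis
    using v w lnorm_nonneg[OF n] lnorm_eq_0[OF n] subspace_diff[OF sub]
    by (metis antisym right_minus_eq)
qed

text \<open>The property that the increment of \<open>\<gamma>\<close> over an interval is, up to the error \<open>e\<close> times its length,
  a velocity in \<open>S\<close> times its length passes to the union of adjacent intervals, as \<open>S\<close> is convex, and holds on all
  short intervals around a point, by differentiability there. Bisection therefore yields it on \<open>{a..b}\<close>.\<close>

lemma mean_value_convex:
  assumes n: "normed_levels E" and S: "S \<subseteq> level E m" "convex S" and ab: "a \<le> b"
    and \<gamma>: "\<And>s. s \<in> {a..b} \<Longrightarrow> \<gamma> s \<in> level E m"
    and deriv: "\<And>s. s \<in> {a..b} \<Longrightarrow> \<exists>v\<in>S. curve_derivative E m {a..b} \<gamma> v s" and e: "e > 0"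
  shows "\<exists>v\<in>S. lnorm E m (\<gamma> b - \<gamma> a - (b - a) *\<^sub>R v) \<le> e * (b - a)"
proof -
  note sub = subspace_level[OF n]
  define P where "P p q \<longleftrightarrow> (a \<le> p \<and> q \<le> b \<longrightarrow>
    (\<exists>v\<in>S. lnorm E m (\<gamma> q - \<gamma> p - (q - p) *\<^sub>R v) \<le> e * (q - p)))" for p q
  have "P a b"
    using ab
  proof (induction rule: Bolzano)
    case (trans p q r)
    show ?case
      unfolding P_def
    proof (intro impI)
      assume ar: "a \<le> p \<and> r \<le> b"
      obtain v w where v: "v \<in> S" "lnorm E m (\<gamma> q - \<gamma> p - (q - p) *\<^sub>R v) \<le> e * (q - p)"
        and w: "w \<in> S" "lnorm E m (\<gamma> r - \<gamma> q - (r - q) *\<^sub>R w) \<le> e * (r - q)"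
        using trans ar unfolding P_def by (meson order_trans)
      show "\<exists>v\<in>S. lnorm E m (\<gamma> r - \<gamma> p - (r - p) *\<^sub>R v) \<le> e * (r - p)"
      proof (cases "p = r")
        case True
        then have "\<gamma> r - \<gamma> p - (r - p) *\<^sub>R v = 0" by simp
        then show ?thesis using v(1) True lnorm_0[OF n] by fastforce
      next
        case False
        define u where "u = ((q - p) / (r - p)) *\<^sub>R v + ((r - q) / (r - p)) *\<^sub>R w"
        have "u \<in> S"
          unfolding u_def using trans False v w
          by (intro convexD[OF S(2)]) (auto simp: add_divide_distrib[symmetric])
        have "(r - p) *\<^sub>R u = (q - p) *\<^sub>R v + (r - q) *\<^sub>R w"
          using False by (simp add: u_def scaleR_add_right)
        then have eq: "\<gamma> r - \<gamma> p - (r - p) *\<^sub>R u =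
            (\<gamma> q - \<gamma> p - (q - p) *\<^sub>R v) + (\<gamma> r - \<gamma> q - (r - q) *\<^sub>R w)"
          by (simp add: algebra_simps)
        have "lnorm E m (\<gamma> r - \<gamma> p - (r - p) *\<^sub>R u) \<le>
            lnorm E m (\<gamma> q - \<gamma> p - (q - p) *\<^sub>R v) + lnorm E m (\<gamma> r - \<gamma> q - (r - q) *\<^sub>R w)"
          unfolding eq using trans ar v w S(1)
          by (intro lnorm_triangle[OF n] subspace_diff[OF sub] subspace_scale[OF sub] \<gamma>) auto
        also have "\<dots> \<le> e * (r - p)" using v(2) w(2) by (simp add: algebra_simps)
        finally show ?thesis using \<open>u \<in> S\<close> by blast
      qed
    qed
  next
    case (local x)
    then obtain v where v: "v \<in> S" "curve_derivative E m {a..b} \<gamma> v x"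
      using deriv by auto
    then obtain d where d: "d > 0" "\<And>t. t \<in> {a..b} \<Longrightarrow> \<bar>t - x\<bar> < d \<Longrightarrow>
        lnorm E m (\<gamma> t - \<gamma> x - (t - x) *\<^sub>R v) \<le> e * \<bar>t - x\<bar>"
      using e unfolding curve_derivative_def by meson
    have "P p q" if pq: "p \<le> x" "x \<le> q" "q - p < d" for p q
      unfolding P_def
    proof (intro impI bexI[of _ v] v(1))
      assume "a \<le> p \<and> q \<le> b"
      then have mem: "p \<in> {a..b}" "q \<in> {a..b}" "x \<in> {a..b}" using pq by auto
      let ?f = "\<lambda>t. \<gamma> t - \<gamma> x - (t - x) *\<^sub>R v"
      have lev: "?f t \<in> level E m" if "t \<in> {a..b}" for t
        using that mem(3) \<gamma> v(1) S(1) by (intro subspace_diff[OF sub] subspace_scale[OF sub]) auto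
      have "\<gamma> q - \<gamma> p - (q - p) *\<^sub>R v = ?f q + (-1) *\<^sub>R ?f p" by (simp add: algebra_simps)
      also have "lnorm E m \<dots> \<le> lnorm E m (?f q) + lnorm E m ((-1) *\<^sub>R ?f p)"
        using lev mem by (intro lnorm_triangle[OF n] subspace_scale[OF sub]) auto
      also have "\<dots> = lnorm E m (?f q) + lnorm E m (?f p)"
        using lnorm_scaleR[OF n lev[OF mem(1)], of "-1"] by simp
      also have "\<dots> \<le> e * \<bar>q - x\<bar> + e * \<bar>p - x\<bar>"
        using mem pq by (intro add_mono d(2)) auto
      also have "\<dots> = e * (q - p)" using pq by (simp add: algebra_simps)
      finally show "lnorm E m (\<gamma> q - \<gamma> p - (q - p) *\<^sub>R v) \<le> e * (q - p)" .
    qed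
    then show ?case using d(1) by blast
  qed
  then show ?thesis by (simp add: P_def)
qed

text \<open>Subtract the motion with velocity \<open>\<gamma>' s\<close>. Near \<open>s\<close> the velocities of the remaining curve lie in a ball of
  radius \<open>e / c\<close> of level \<open>m + 1\<close>. By the mean value theorem its difference quotients are limits, in
  level \<open>0\<close>, of elements of this ball, so by compactness their norm in level \<open>m\<close> is at most \<open>e\<close>.\<close>

lemma curve_derivative_level_gain:
  assumes E: "sc_Banach E" and s: "s \<in> {a..b}"
    and \<gamma>: "\<And>t. t \<in> {a..b} \<Longrightarrow> \<gamma> t \<in> level E 0"
    and \<gamma>': "\<And>t. t \<in> {a..b} \<Longrightarrow> \<gamma>' t \<in> level E (Suc m)"
    and deriv: "\<And>t. t \<in> {a..b} \<Longrightarrow> curve_derivative E 0 {a..b} \<gamma> (\<gamma>' t) t"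
    and cont: "\<And>e. e > 0 \<Longrightarrow>
      \<exists>d>0. \<forall>t\<in>{a..b}. \<bar>t - s\<bar> < d \<longrightarrow> lnorm E (Suc m) (\<gamma>' t - \<gamma>' s) < e"
  shows "curve_derivative E m {a..b} \<gamma> (\<gamma>' s) s"
  unfolding curve_derivative_def
proof (intro allI impI)
  fix e :: real assume e: "e > 0"
  note n = sc_Banach_normed[OF E]
  note sub = subspace_level[OF n]
  have nest: "level E (Suc m) \<subseteq> level E 0" using level_antimono[OF n] by blast
  obtain c where c: "c > 0"
    "\<And>v. v \<in> level E 0 \<Longrightarrow>
      (\<And>e. e > 0 \<Longrightarrow> \<exists>b\<in>level E (Suc m). lnorm E (Suc m) b \<le> 1 \<and> lnorm E 0 (v - b) \<le> e) \<Longrightarrow>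
      v \<in> level E m \<and> lnorm E m v \<le> c"
    using unit_ball_limit_bounded[OF E, of m] by blast
  define r where "r = e / c"
  have r: "r > 0" using e c(1) by (simp add: r_def)
  obtain d where d: "d > 0"
    "\<And>t. t \<in> {a..b} \<Longrightarrow> \<bar>t - s\<bar> < d \<Longrightarrow> lnorm E (Suc m) (\<gamma>' t - \<gamma>' s) < r"
    using cont[OF r] by blast
  define S where "S = {v \<in> level E (Suc m). lnorm E (Suc m) v \<le> r}"
  have "convex S"
  proof (rule convexI)
    fix x y and u v :: real assume xy: "x \<in> S" "y \<in> S" "0 \<le> u" "0 \<le> v" "u + v = 1"
    have "lnorm E (Suc m) (u *\<^sub>R x + v *\<^sub>R y) \<le> lnorm E (Suc m) (u *\<^sub>R x) + lnorm E (Suc m) (v *\<^sub>R y)"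
      using xy by (intro lnorm_triangle[OF n] subspace_scale[OF sub]) (auto simp: S_def)
    also have "\<dots> = u * lnorm E (Suc m) x + v * lnorm E (Suc m) y"
      using xy by (simp add: lnorm_scaleR[OF n] S_def)
    also have "\<dots> \<le> u * r + v * r"
      using xy by (intro add_mono mult_left_mono) (auto simp: S_def)
    also have "\<dots> = r" using xy(5) by (metis distrib_right mult_1)
    finally show "u *\<^sub>R x + v *\<^sub>R y \<in> S"
      using xy by (auto simp: S_def intro!: subspace_add[OF sub] subspace_scale[OF sub])
  qed
  define \<zeta> where "\<zeta> u = \<gamma> u - u *\<^sub>R \<gamma>' s" for u
  have \<gamma>'s: "\<gamma>' s \<in> level E 0" using \<gamma>'[OF s] nest by blast
  have \<zeta>: "\<zeta> u \<in> level E 0" if "u \<in> {a..b}" for u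
    unfolding \<zeta>_def using that \<gamma> \<gamma>'s by (intro subspace_diff[OF sub] subspace_scale[OF sub]) auto
  have bound: "\<zeta> q - \<zeta> p \<in> level E m \<and> lnorm E m (\<zeta> q - \<zeta> p) \<le> e * (q - p)"
    if pq: "p < q" "{p..q} \<subseteq> {a..b}" "\<And>u. u \<in> {p..q} \<Longrightarrow> \<bar>u - s\<bar> < d" for p q
  proof -
    \<comment> \<open>Rescaling to the unit ball: \<open>?w\<close> is the limit in level \<open>0\<close> of elements of norm at most \<open>1\<close>.\<close>
    let ?w = "(1 / (r * (q - p))) *\<^sub>R (\<zeta> q - \<zeta> p)"
    have mem: "p \<in> {a..b}" "q \<in> {a..b}" using pq by auto
    have w0: "?w \<in> level E 0"
      using mem \<zeta> by (intro subspace_diff[OF sub] subspace_scale[OF sub]) auto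
    have "\<exists>b\<in>level E (Suc m). lnorm E (Suc m) b \<le> 1 \<and> lnorm E 0 (?w - b) \<le> \<epsilon>" if \<epsilon>: "\<epsilon> > 0" for \<epsilon>
    proof -
      have "\<exists>v\<in>S. lnorm E 0 (\<zeta> q - \<zeta> p - (q - p) *\<^sub>R v) \<le> (r * \<epsilon>) * (q - p)"
      proof (rule mean_value_convex[OF n _ \<open>convex S\<close>])
        show "S \<subseteq> level E 0" using nest by (auto simp: S_def)
        show "\<zeta> u \<in> level E 0" if "u \<in> {p..q}" for u using that pq \<zeta> by blast
        show "\<exists>v\<in>S. curve_derivative E 0 {p..q} \<zeta> v u" if u: "u \<in> {p..q}" for u
        proof
          have u': "u \<in> {a..b}" using u pq by blast
          show "\<gamma>' u - \<gamma>' s \<in> S"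
            using d(2)[OF u' pq(3)[OF u]] \<gamma>' u' s by (auto simp: S_def intro!: subspace_diff[OF sub])
          have "\<zeta> t - \<zeta> u - (t - u) *\<^sub>R (\<gamma>' u - \<gamma>' s) = \<gamma> t - \<gamma> u - (t - u) *\<^sub>R \<gamma>' u" for t
            by (simp add: \<zeta>_def algebra_simps)
          then show "curve_derivative E 0 {p..q} \<zeta> (\<gamma>' u - \<gamma>' s) u"
            using curve_derivative_subset[OF deriv[OF u'] pq(2)] by (simp add: curve_derivative_def)
        qed
        show "0 < r * \<epsilon>" using r \<epsilon> by simp
      qed (use pq in auto)
      then obtain v where v: "v \<in> S" "lnorm E 0 (\<zeta> q - \<zeta> p - (q - p) *\<^sub>R v) \<le> (r * \<epsilon>) * (q - p)" by blast
      have "v \<in> level E 0" using v(1) nest by (auto simp: S_def)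
      have "?w - (1 / r) *\<^sub>R v = (1 / (r * (q - p))) *\<^sub>R (\<zeta> q - \<zeta> p - (q - p) *\<^sub>R v)"
        using pq(1) by (simp add: scaleR_diff_right)
      also have "lnorm E 0 \<dots> = 1 / (r * (q - p)) * lnorm E 0 (\<zeta> q - \<zeta> p - (q - p) *\<^sub>R v)"
        using mem \<zeta> \<open>v \<in> level E 0\<close> r pq(1)
        by (subst lnorm_scaleR[OF n]) (auto intro!: subspace_diff[OF sub] subspace_scale[OF sub])
      also have "\<dots> \<le> 1 / (r * (q - p)) * (r * \<epsilon> * (q - p))"
        using v(2) r pq(1) by (intro mult_left_mono) auto
      also have "\<dots> = \<epsilon>" using r pq(1) by simp
      finally have "lnorm E 0 (?w - (1 / r) *\<^sub>R v) \<le> \<epsilon>" .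
      moreover have "lnorm E (Suc m) ((1 / r) *\<^sub>R v) \<le> 1"
        using v(1) r by (simp add: S_def lnorm_scaleR[OF n])
      moreover have "(1 / r) *\<^sub>R v \<in> level E (Suc m)"
        using v(1) by (auto simp: S_def intro!: subspace_scale[OF sub])
      ultimately show ?thesis by blast
    qed
    from c(2)[OF w0 this] have w: "?w \<in> level E m" "lnorm E m ?w \<le> c" by auto
    have eq: "\<zeta> q - \<zeta> p = (r * (q - p)) *\<^sub>R ?w" using r pq(1) by simp
    have "lnorm E m (\<zeta> q - \<zeta> p) = (r * (q - p)) * lnorm E m ?w"
      using r pq(1) by (subst eq, subst lnorm_scaleR[OF n w(1)]) simp
    also have "\<dots> \<le> (r * (q - p)) * c" using w(2) r pq(1) by (intro mult_left_mono) auto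
    also have "\<dots> = e * (q - p)" using c(1) by (simp add: r_def)
    finally show ?thesis using eq subspace_scale[OF sub w(1)] by metis
  qed
  have "lnorm E m (\<gamma> t - \<gamma> s - (t - s) *\<^sub>R \<gamma>' s) \<le> e * \<bar>t - s\<bar>"
    if t: "t \<in> {a..b}" "\<bar>t - s\<bar> < d" for t
  proof -
    have eq: "\<gamma> t - \<gamma> s - (t - s) *\<^sub>R \<gamma>' s = \<zeta> t - \<zeta> s" by (simp add: \<zeta>_def algebra_simps)
    consider "t = s" | "s < t" | "t < s" by linarith
    then show ?thesis
    proof cases
      case 1
      then show ?thesis by (simp add: lnorm_0[OF n])
    next
      case 2
      then show ?thesis unfolding eq using bound[of s t] t s by auto
    next
      case 3
      have "\<zeta> s - \<zeta> t \<in> level E m \<and> lnorm E m (\<zeta> s - \<zeta> t) \<le> e * (s - t)"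
        using 3 t s by (intro bound) auto
      moreover have "\<zeta> t - \<zeta> s = (-1) *\<^sub>R (\<zeta> s - \<zeta> t)" by simp
      ultimately show ?thesis unfolding eq using 3 lnorm_scaleR[OF n, of "\<zeta> s - \<zeta> t" m "-1"] by simp
    qed
  qed
  then show "\<exists>d>0. \<forall>t\<in>{a..b}. \<bar>t - s\<bar> < d \<longrightarrow>
      lnorm E m (\<gamma> t - \<gamma> s - (t - s) *\<^sub>R \<gamma>' s) \<le> e * \<bar>t - s\<bar>"
    using d(1) by blast
qed

text \<open>The increments of \<open>\<gamma>\<close> have to be controlled in level \<open>1\<close>, where the remainder of \<open>\<phi>\<close> is small relative to them, and
  in level \<open>0\<close>, where \<open>D\<close> is bounded.\<close>

lemma curve_derivative_compose:
  assumes E: "normed_levels E" and F: "normed_levels F"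
    and D: "has_sc_derivative E U F \<phi> (\<gamma> s) D" and s: "s \<in> X"
    and \<gamma>: "\<And>t. t \<in> X \<Longrightarrow> \<gamma> t \<in> U \<inter> level E 1" and v: "v \<in> level E 1"
    and d1: "curve_derivative E 1 X \<gamma> v s" and d0: "curve_derivative E 0 X \<gamma> v s"
    and \<phi>: "\<And>t. t \<in> X \<Longrightarrow> \<phi> (\<gamma> t) \<in> level F 0"
  shows "curve_derivative F 0 X (\<lambda>t. \<phi> (\<gamma> t)) (D v) s"
  unfolding curve_derivative_def
proof (intro allI impI)
  fix e :: real assume e: "e > 0"
  note sub = subspace_level[OF E] and subF = subspace_level[OF F]
  have nest: "level E 1 \<subseteq> level E 0" using level_antimono[OF E] by blast
  have lin: "linear_on_set (level E 0) D" and D0: "\<And>h. h \<in> level E 0 \<Longrightarrow> D h \<in> level F 0"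
    using D by (auto simp: has_sc_derivative_def)
  obtain B0 where B0: "\<And>h. h \<in> level E 0 \<Longrightarrow> lnorm F 0 (D h) \<le> B0 * lnorm E 0 h"
    using D unfolding has_sc_derivative_def by blast
  define B where "B = \<bar>B0\<bar> + 1"
  have B: "lnorm F 0 (D h) \<le> B * lnorm E 0 h" if "h \<in> level E 0" for h
  proof -
    have "B0 \<le> B" by (simp add: B_def)
    from mult_right_mono[OF this lnorm_nonneg[OF E that]] show ?thesis using B0[OF that] by linarith
  qed
  define M where "M = lnorm E 1 v + 1"
  have M: "M > 0" using lnorm_nonneg[OF E v] by (simp add: M_def)
  have Bpos: "B > 0" by (simp add: B_def)
  obtain \<delta>1 where \<delta>1: "\<delta>1 > 0" "\<And>t. t \<in> X \<Longrightarrow> \<bar>t - s\<bar> < \<delta>1 \<Longrightarrow>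
      lnorm E 1 (\<gamma> t - \<gamma> s - (t - s) *\<^sub>R v) \<le> 1 * \<bar>t - s\<bar>"
    using d1 unfolding curve_derivative_def by (meson zero_less_one)
  have "e / (2 * B) > 0" using e Bpos by simp
  then obtain \<delta>0 where \<delta>0: "\<delta>0 > 0" "\<And>t. t \<in> X \<Longrightarrow> \<bar>t - s\<bar> < \<delta>0 \<Longrightarrow>
      lnorm E 0 (\<gamma> t - \<gamma> s - (t - s) *\<^sub>R v) \<le> e / (2 * B) * \<bar>t - s\<bar>"
    using d0 unfolding curve_derivative_def by meson
  have "e / (2 * M) > 0" using e M by simp
  then obtain \<delta> where \<delta>: "\<delta> > 0" "\<And>h. h \<in> level E 1 \<Longrightarrow> \<gamma> s + h \<in> U \<Longrightarrow> 0 < lnorm E 1 h \<Longrightarrow>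
      lnorm E 1 h < \<delta> \<Longrightarrow> lnorm F 0 (\<phi> (\<gamma> s + h) - \<phi> (\<gamma> s) - D h) / lnorm E 1 h < e / (2 * M)"
    using D unfolding has_sc_derivative_def by meson
  have "lnorm F 0 (\<phi> (\<gamma> t) - \<phi> (\<gamma> s) - (t - s) *\<^sub>R D v) \<le> e * \<bar>t - s\<bar>"
    if t: "t \<in> X" "\<bar>t - s\<bar> < min (min \<delta>1 \<delta>0) (\<delta> / M)" for t
  proof -
    define h where "h = \<gamma> t - \<gamma> s"
    define k where "k = h - (t - s) *\<^sub>R v"
    have h: "h \<in> level E 1" unfolding h_def using \<gamma> t s by (intro subspace_diff[OF sub]) auto
    have k1: "k \<in> level E 1" unfolding k_def using h v by (intro subspace_diff[OF sub] subspace_scale[OF sub])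
    have tv: "(t - s) *\<^sub>R v \<in> level E 1" using v by (intro subspace_scale[OF sub])
    have h0: "h \<in> level E 0" "k \<in> level E 0" "(t - s) *\<^sub>R v \<in> level E 0" "v \<in> level E 0"
      using h k1 tv v nest by auto
    have "lnorm E 1 ((t - s) *\<^sub>R v + k) \<le> lnorm E 1 ((t - s) *\<^sub>R v) + lnorm E 1 k"
      by (rule lnorm_triangle[OF E tv k1])
    also have "\<dots> \<le> \<bar>t - s\<bar> * lnorm E 1 v + \<bar>t - s\<bar>"
      using \<delta>1(2)[OF t(1)] t(2) by (simp add: lnorm_scaleR[OF E v] k_def h_def del: One_nat_def)
    finally have hM: "lnorm E 1 h \<le> M * \<bar>t - s\<bar>"
      by (simp add: k_def M_def algebra_simps del: One_nat_def)
    have "M * \<bar>t - s\<bar> < \<delta>" using t(2) M by (simp add: field_simps)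
    with hM have h\<delta>: "lnorm E 1 h < \<delta>" by linarith
    have main: "lnorm F 0 (\<phi> (\<gamma> t) - \<phi> (\<gamma> s) - D h) \<le> e / (2 * M) * lnorm E 1 h"
    proof (cases "h = 0")
      case True
      then have "D h = 0"
        using linear_on_set_diff[OF sub lin h0(1) h0(1)] by simp
      then show ?thesis using True by (simp add: h_def lnorm_0[OF F] lnorm_0[OF E])
    next
      case False
      then have "lnorm E 1 h > 0"
        using lnorm_eq_0[OF E h] lnorm_nonneg[OF E h] by linarith
      moreover have "\<gamma> s + h = \<gamma> t" by (simp add: h_def)
      ultimately have "lnorm F 0 (\<phi> (\<gamma> t) - \<phi> (\<gamma> s) - D h) / lnorm E 1 h < e / (2 * M)"
        using \<delta>(2)[OF h _ _ h\<delta>] \<gamma>[OF t(1)] by simp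
      then show ?thesis using \<open>lnorm E 1 h > 0\<close> by (simp add: pos_divide_less_eq del: One_nat_def)
    qed
    also have "\<dots> \<le> e / (2 * M) * (M * \<bar>t - s\<bar>)"
      using hM e M by (intro mult_left_mono) auto
    also have "\<dots> = e / 2 * \<bar>t - s\<bar>" using M by simp
    finally have 1: "lnorm F 0 (\<phi> (\<gamma> t) - \<phi> (\<gamma> s) - D h) \<le> e / 2 * \<bar>t - s\<bar>" .
    have "lnorm F 0 (D k) \<le> B * lnorm E 0 k" using B h0 by blast
    also have "\<dots> \<le> B * (e / (2 * B) * \<bar>t - s\<bar>)"
      using \<delta>0(2)[OF t(1)] t(2) Bpos by (intro mult_left_mono) (auto simp: k_def h_def)
    also have "\<dots> = e / 2 * \<bar>t - s\<bar>" using Bpos by simp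
    finally have 2: "lnorm F 0 (D k) \<le> e / 2 * \<bar>t - s\<bar>" .
    have "D k = D h - (t - s) *\<^sub>R D v"
      unfolding k_def using linear_on_set_diff[OF sub lin h0(1,3)] lin h0(4)
      by (simp add: linear_on_set_def)
    then have eq: "\<phi> (\<gamma> t) - \<phi> (\<gamma> s) - (t - s) *\<^sub>R D v = (\<phi> (\<gamma> t) - \<phi> (\<gamma> s) - D h) + D k" by simp
    have "lnorm F 0 (\<phi> (\<gamma> t) - \<phi> (\<gamma> s) - (t - s) *\<^sub>R D v) \<le>
        lnorm F 0 (\<phi> (\<gamma> t) - \<phi> (\<gamma> s) - D h) + lnorm F 0 (D k)"
      unfolding eq using \<phi> t s D0 h0 by (intro lnorm_triangle[OF F] subspace_diff[OF subF]) auto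
    then show ?thesis using 1 2 by simp
  qed
  moreover have "min (min \<delta>1 \<delta>0) (\<delta> / M) > 0" using \<delta>1 \<delta>0 \<delta> M by simp
  ultimately show "\<exists>d>0. \<forall>t\<in>X. \<bar>t - s\<bar> < d \<longrightarrow>
      lnorm F 0 (\<phi> (\<gamma> t) - \<phi> (\<gamma> s) - (t - s) *\<^sub>R D v) \<le> e * \<bar>t - s\<bar>"
    by blast
qed

section \<open>The chain rule along sc-curves\<close>

text \<open>All levels are involved at once because an sc-differentiable map needs its increments in level
  \<open>m + 1\<close> to produce a derivative in level \<open>m\<close>: composition would not preserve a condition on
  finitely many levels.\<close>

definition sc_curve :: "'a::real_vector sc_space \<Rightarrow> real \<Rightarrow> (real \<Rightarrow> 'a) \<Rightarrow> (real \<Rightarrow> 'a) \<Rightarrow> bool" where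
  "sc_curve E \<tau> \<gamma> \<gamma>' \<longleftrightarrow> (\<forall>m. \<forall>s\<in>{0..\<tau>}.
     \<gamma> s \<in> level E m \<and> \<gamma>' s \<in> level E m \<and> curve_derivative E m {0..\<tau>} \<gamma> (\<gamma>' s) s \<and>
     (\<forall>e>0. \<exists>d>0. \<forall>t\<in>{0..\<tau>}. \<bar>t - s\<bar> < d \<longrightarrow> lnorm E m (\<gamma>' t - \<gamma>' s) < e))"

definition sc1_with ::
  "'a::real_vector sc_space \<Rightarrow> 'a set \<Rightarrow> 'b::real_vector sc_space \<Rightarrow> 'b set \<Rightarrow> ('a \<Rightarrow> 'b) \<Rightarrow> ('a \<Rightarrow> 'a \<Rightarrow> 'b) \<Rightarrow> bool"
  where
  "sc1_with E U F V \<phi> D \<longleftrightarrow> sc0 E U F V \<phi> \<and>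
     (\<forall>x \<in> U \<inter> level E 1. has_sc_derivative E U F \<phi> x (D x)) \<and>
     sc0 (tangent_space E) (tangent_set E U) (tangent_space F) (tangent_set F V) (tangent_map \<phi> D)"

lemma sc_map_1_iff:
  assumes "normed_levels E" "normed_levels F"
  shows "sc_map 1 E U F V \<phi> \<longleftrightarrow> (\<exists>D. sc1_with E U F V \<phi> D)"
  unfolding One_nat_def sc_map_Suc[OF assms]
    sc_map_0[OF normed_levels_tangent_space[OF assms(1)] normed_levels_tangent_space[OF assms(2)]]
    sc1_with_def
  by simp

lemma curve_derivative_continuous:
  assumes n: "normed_levels E" and \<gamma>: "\<And>t. t \<in> X \<Longrightarrow> \<gamma> t \<in> level E m" and v: "v \<in> level E m"
    and s: "s \<in> X" and deriv: "curve_derivative E m X \<gamma> v s" and e: "e > 0"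
  shows "\<exists>d>0. \<forall>t\<in>X. \<bar>t - s\<bar> < d \<longrightarrow> lnorm E m (\<gamma> t - \<gamma> s) < e"
proof -
  note sub = subspace_level[OF n]
  define M where "M = lnorm E m v + 1"
  have M: "M > 0" using lnorm_nonneg[OF n v] by (simp add: M_def)
  obtain d where d: "d > 0" "\<And>t. t \<in> X \<Longrightarrow> \<bar>t - s\<bar> < d \<Longrightarrow>
      lnorm E m (\<gamma> t - \<gamma> s - (t - s) *\<^sub>R v) \<le> 1 * \<bar>t - s\<bar>"
    using deriv unfolding curve_derivative_def by (meson zero_less_one)
  have "lnorm E m (\<gamma> t - \<gamma> s) < e" if t: "t \<in> X" "\<bar>t - s\<bar> < min d (e / M)" for t
  proof -
    have "lnorm E m ((\<gamma> t - \<gamma> s - (t - s) *\<^sub>R v) + (t - s) *\<^sub>R v) \<le>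
        lnorm E m (\<gamma> t - \<gamma> s - (t - s) *\<^sub>R v) + lnorm E m ((t - s) *\<^sub>R v)"
      using \<gamma> t s v by (intro lnorm_triangle[OF n] subspace_diff[OF sub] subspace_scale[OF sub])
    also have "\<dots> \<le> M * \<bar>t - s\<bar>"
      using d(2)[OF t(1)] t(2) by (simp add: M_def lnorm_scaleR[OF n v] distrib_right)
    also have "\<dots> < e" using t(2) M by (simp add: field_simps)
    finally show ?thesis by simp
  qed
  then show ?thesis using d(1) e M by (intro exI[of _ "min d (e / M)"]) auto
qed

text \<open>In level \<open>0\<close> the chain rule is a direct computation. Its other ingredient is that the tangent map is
  continuous on all levels: it makes the velocity of the image curve continuous in level \<open>m + 1\<close>, which
  turns differentiability in level \<open>0\<close> into differentiability in level \<open>m\<close>.\<close>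

lemma sc_curve_compose:
  assumes E: "normed_levels E" and F: "sc_Banach F"
    and \<phi>: "sc1_with E U F V \<phi> D"
    and \<gamma>: "sc_curve E \<tau> \<gamma> \<gamma>'" and U: "\<And>s. s \<in> {0..\<tau>} \<Longrightarrow> \<gamma> s \<in> U"
  shows "sc_curve F \<tau> (\<lambda>s. \<phi> (\<gamma> s)) (\<lambda>s. D (\<gamma> s) (\<gamma>' s))"
proof -
  note nF = sc_Banach_normed[OF F]
  have lev: "\<gamma> s \<in> level E m" "\<gamma>' s \<in> level E m" and der: "curve_derivative E m {0..\<tau>} \<gamma> (\<gamma>' s) s"
    and cont: "e > 0 \<Longrightarrow> \<exists>d>0. \<forall>t\<in>{0..\<tau>}. \<bar>t - s\<bar> < d \<longrightarrow> lnorm E m (\<gamma>' t - \<gamma>' s) < e"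
    if "s \<in> {0..\<tau>}" for s m e
    using \<gamma> that unfolding sc_curve_def by blast+
  have sc0: "sc0 E U F V \<phi>"
    and sder: "\<And>x. x \<in> U \<inter> level E 1 \<Longrightarrow> has_sc_derivative E U F \<phi> x (D x)"
    and tan: "sc0 (tangent_space E) (tangent_set E U) (tangent_space F) (tangent_set F V) (tangent_map \<phi> D)"
    using \<phi> by (auto simp: sc1_with_def)
  have \<phi>lev: "\<phi> (\<gamma> s) \<in> level F m" if "s \<in> {0..\<tau>}" for s m
    using sc0 U[OF that] lev[OF that] unfolding sc0_iff[OF E nF] by blast
  note tan' = tan[unfolded sc0_iff[OF normed_levels_tangent_space[OF E] normed_levels_tangent_space[OF nF]]]
  have tlev: "(\<gamma> s, \<gamma>' s) \<in> level (tangent_space E) m \<inter> tangent_set E U" if "s \<in> {0..\<tau>}" for s m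
    using U[OF that] lev[OF that] by (simp add: tangent_space_def sc_sum_def sc_shift_def tangent_set_def)
  have tim: "(\<phi> (\<gamma> s), D (\<gamma> s) (\<gamma>' s)) \<in> level (tangent_space F) m" if s: "s \<in> {0..\<tau>}" for s m
  proof -
    have "tangent_map \<phi> D (\<gamma> s, \<gamma>' s) \<in> level (tangent_space F) m \<inter> tangent_set F V"
      using tan' tlev[OF s, of m] by blast
    then show ?thesis by (simp add: tangent_map_def)
  qed
  then have Dlev: "D (\<gamma> s) (\<gamma>' s) \<in> level F m" if "s \<in> {0..\<tau>}" for s m
    using that by (simp add: tangent_space_def sc_sum_def sc_shift_def)
  have Dcont: "\<exists>d>0. \<forall>t\<in>{0..\<tau>}. \<bar>t - s\<bar> < d \<longrightarrow> lnorm F m (D (\<gamma> t) (\<gamma>' t) - D (\<gamma> s) (\<gamma>' s)) < e"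
    if s: "s \<in> {0..\<tau>}" and e: "e > 0" for s m e
  proof -
    obtain \<delta> where \<delta>: "\<delta> > 0" "\<And>q. q \<in> level (tangent_space E) m \<inter> tangent_set E U \<Longrightarrow>
        lnorm (tangent_space E) m ((\<gamma> s, \<gamma>' s) - q) < \<delta> \<Longrightarrow>
        lnorm (tangent_space F) m (tangent_map \<phi> D (\<gamma> s, \<gamma>' s) - tangent_map \<phi> D q) < e"
      using tan' tlev[OF s, of m] e by blast
    obtain d1 where d1: "d1 > 0"
      "\<And>t. t \<in> {0..\<tau>} \<Longrightarrow> \<bar>t - s\<bar> < d1 \<Longrightarrow> lnorm E (Suc m) (\<gamma> t - \<gamma> s) < \<delta> / 2"
      using curve_derivative_continuous[OF E lev(1) lev(2)[OF s] s der[OF s], of "\<delta> / 2" "Suc m"] \<delta>(1) by auto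
    obtain d2 where d2: "d2 > 0"
      "\<And>t. t \<in> {0..\<tau>} \<Longrightarrow> \<bar>t - s\<bar> < d2 \<Longrightarrow> lnorm E m (\<gamma>' t - \<gamma>' s) < \<delta> / 2"
      using cont[OF s, of "\<delta> / 2" m] \<delta>(1) by auto
    have "lnorm F m (D (\<gamma> t) (\<gamma>' t) - D (\<gamma> s) (\<gamma>' s)) < e"
      if t: "t \<in> {0..\<tau>}" "\<bar>t - s\<bar> < min d1 d2" for t
    proof -
      have "lnorm E (Suc m) (\<gamma> s - \<gamma> t) + lnorm E m (\<gamma>' s - \<gamma>' t) < \<delta> / 2 + \<delta> / 2"
        using d1(2)[OF t(1)] d2(2)[OF t(1)] t(2) lnorm_minus_commute[OF E lev(1)[OF s] lev(1)[OF t(1)]]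
          lnorm_minus_commute[OF E lev(2)[OF s] lev(2)[OF t(1)]]
        by (intro add_strict_mono) auto
      then have "lnorm (tangent_space E) m ((\<gamma> s, \<gamma>' s) - (\<gamma> t, \<gamma>' t)) < \<delta>"
        by (simp add: tangent_space_def sc_sum_def sc_shift_def)
      from \<delta>(2)[OF tlev[OF t(1)] this]
      have "lnorm F (Suc m) (\<phi> (\<gamma> s) - \<phi> (\<gamma> t)) + lnorm F m (D (\<gamma> s) (\<gamma>' s) - D (\<gamma> t) (\<gamma>' t)) < e"
        by (simp add: tangent_space_def sc_sum_def sc_shift_def tangent_map_def)
      moreover have "lnorm F (Suc m) (\<phi> (\<gamma> s) - \<phi> (\<gamma> t)) \<ge> 0"
        using \<phi>lev s t by (intro lnorm_nonneg[OF nF] subspace_diff[OF subspace_level[OF nF]])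
      ultimately show ?thesis
        using lnorm_minus_commute[OF nF Dlev[OF s] Dlev[OF t(1)]] by simp
    qed
    then show ?thesis using d1(1) d2(1) by (intro exI[of _ "min d1 d2"]) auto
  qed
  have D0: "curve_derivative F 0 {0..\<tau>} (\<lambda>s. \<phi> (\<gamma> s)) (D (\<gamma> s) (\<gamma>' s)) s" if s: "s \<in> {0..\<tau>}" for s
    using U lev der[OF s] s \<phi>lev by (intro curve_derivative_compose[OF E nF sder]) auto
  show ?thesis
    unfolding sc_curve_def
  proof (intro allI ballI conjI)
    fix m s assume s: "s \<in> {0..\<tau>}"
    show "curve_derivative F m {0..\<tau>} (\<lambda>s. \<phi> (\<gamma> s)) (D (\<gamma> s) (\<gamma>' s)) s"
      by (rule curve_derivative_level_gain[OF F s, where \<gamma>' = "\<lambda>s. D (\<gamma> s) (\<gamma>' s)"])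
        (use \<phi>lev Dlev D0 Dcont[OF s] in auto)
  qed (use \<phi>lev Dlev Dcont in auto)
qed

lemma curve_derivative_line: "normed_levels E \<Longrightarrow> curve_derivative E m X (\<lambda>t. x + t *\<^sub>R h) h s"
  by (auto simp: curve_derivative_def lnorm_0 scaleR_left_diff_distrib intro!: exI[of _ 1])

lemma sc_curve_line:
  assumes "normed_levels E" "x \<in> smooth_points E" "h \<in> smooth_points E"
  shows "sc_curve E \<tau> (\<lambda>t. x + t *\<^sub>R h) (\<lambda>_. h)"
proof -
  have "x \<in> level E m" "h \<in> level E m" for m
    using assms by (auto simp: smooth_points_def)
  then have "x + t *\<^sub>R h \<in> level E m" "h \<in> level E m" for t m
    by (simp_all add: subspace_add subspace_scale subspace_level[OF assms(1)])
  then show ?thesis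
    unfolding sc_curve_def
    using curve_derivative_line[OF assms(1)] by (simp add: lnorm_0[OF assms(1)])
qed

section \<open>Coordinates of a partial quadrant\<close>

text \<open>This is what the arguments below use of a chart \<open>T\<close>, whose coordinates \<open>l i\<close> are the components of
  its part in \<open>\<real>\<^sup>k\<close>. The last conjunct expresses their linear independence.\<close>

definition quadrant_coordinates ::
  "'a::real_vector sc_space \<Rightarrow> 'a set \<Rightarrow> nat \<Rightarrow> (nat \<Rightarrow> 'a \<Rightarrow> real) \<Rightarrow> bool" where
  "quadrant_coordinates E C k l \<longleftrightarrow>
     (\<forall>i<k. linear_on_set (level E 0) (l i) \<and> (\<exists>B. \<forall>x\<in>level E 0. \<bar>l i x\<bar> \<le> B * lnorm E 0 x)) \<and>
     C = {x \<in> level E 0. \<forall>i<k. 0 \<le> l i x} \<and>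
     (\<forall>r. \<exists>x\<in>level E 0. \<forall>i<k. l i x = r i)"

lemma normed_levels_sc_Rn: "normed_levels (sc_Rn k)"
proof -
  have "norm_on V (\<lambda>r. L2_set r {..<k})" if V: "V = {r :: nat \<Rightarrow> real. \<forall>i\<ge>k. r i = 0}" for V
    unfolding norm_on_def
  proof (intro conjI ballI allI)
    fix x y :: "nat \<Rightarrow> real" and c :: real assume "x \<in> V"
    then show "L2_set x {..<k} = 0 \<longleftrightarrow> x = 0"
      by (simp add: V L2_set_eq_0_iff fun_eq_iff) (meson lessThan_iff not_le)
    show "L2_set (c *\<^sub>R x) {..<k} = \<bar>c\<bar> * L2_set x {..<k}"
      by (simp add: L2_set_def scaleR_fun_def power_mult_distrib sum_distrib_left[symmetric] real_sqrt_mult)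
    show "L2_set (x + y) {..<k} \<le> L2_set x {..<k} + L2_set y {..<k}"
      using L2_set_triangle_ineq[of x y] by (simp add: plus_fun_def)
  qed (rule L2_set_nonneg)
  then show ?thesis
    by (auto simp: normed_levels_def sc_Rn_def subspace_def scaleR_fun_def)
qed

lemma normed_levels_sc_sum:
  assumes "normed_levels E" "normed_levels F"
  shows "normed_levels (sc_sum E F)"
proof -
  have "norm_on (V \<times> W) (\<lambda>(x, y). p x + q y)"
    if p: "norm_on V p" and q: "norm_on W q" for V :: "'a set" and W :: "'b set" and p q
    unfolding norm_on_def
  proof (intro conjI ballI allI)
    fix x assume x: "x \<in> V \<times> W"
    then show "0 \<le> (case x of (x, y) \<Rightarrow> p x + q y)" "((case x of (x, y) \<Rightarrow> p x + q y) = 0) = (x = 0)"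
      using p q by (auto simp: norm_on_def add_nonneg_eq_0_iff zero_prod_def)
    show "(case c *\<^sub>R x of (x, y) \<Rightarrow> p x + q y) = \<bar>c\<bar> * (case x of (x, y) \<Rightarrow> p x + q y)" for c
      using x p q by (auto simp: norm_on_def distrib_left)
    fix y assume y: "y \<in> V \<times> W"
    have "p (fst x + fst y) \<le> p (fst x) + p (fst y)" "q (snd x + snd y) \<le> q (snd x) + q (snd y)"
      using x y p q by (auto simp: norm_on_def)
    then show "(case x + y of (x, y) \<Rightarrow> p x + q y) \<le>
        (case x of (x, y) \<Rightarrow> p x + q y) + (case y of (x, y) \<Rightarrow> p x + q y)"
      by (simp add: case_prod_beta)
  qed
  then show ?thesis
    using assms by (auto simp: normed_levels_def sc_sum_def subspace_Times)
qed

lemma quadrant_chart_coordinates: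
  assumes E: "normed_levels E" and C: "C \<subseteq> level E 0" and chart: "quadrant_chart E C k W T"
  shows "quadrant_coordinates E C k (\<lambda>i x. fst (T x) i)"
proof -
  let ?F = "sc_sum (sc_Rn k) W"
  note sub = subspace_level[OF E]
  have W: "normed_levels W" and iso: "sc_isomorphism E ?F T"
    and TC: "T ` C = {r \<in> level (sc_Rn k) 0. \<forall>i<k. 0 \<le> r i} \<times> level W 0"
    using chart by (auto simp: quadrant_chart_def sc_Banach_normed)
  have F: "normed_levels ?F" by (intro normed_levels_sc_sum normed_levels_sc_Rn W)
  have bij: "bij_betw T (level E 0) (level ?F 0)" and lin: "linear_on_set (level E 0) T"
    and sc: "\<And>m. continuous_map (level_top E m) (level_top ?F m) T"
    using iso by (auto simp: sc_isomorphism_def sc_operator_def)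
  have F0: "level ?F 0 = {r. \<forall>i\<ge>k. r i = 0} \<times> level W 0" by (simp add: sc_sum_def sc_Rn_def)
  have T0: "T x \<in> level ?F 0" if "x \<in> level E 0" for x using bij that by (auto simp: bij_betw_def)
  have "sc0 E UNIV ?F UNIV T" using sc by (simp add: sc0_def)
  then obtain \<delta> where \<delta>: "\<delta> > 0"
    "\<And>y. y \<in> level E 0 \<Longrightarrow> lnorm E 0 (0 - y) < \<delta> \<Longrightarrow> lnorm ?F 0 (T 0 - T y) < 1"
    unfolding sc0_iff[OF E F] using subspace_0[OF sub] by (metis Int_UNIV_right zero_less_one)
  have small: "fst (T u) i \<le> 1" if u: "u \<in> level E 0" "lnorm E 0 u < \<delta>" and i: "i < k" for u i
  proof -
    have mu: "- u \<in> level E 0" using u subspace_neg[OF sub] by blast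
    have "T 0 - T (- u) = T u"
      using linear_on_set_diff[OF sub lin subspace_0[OF sub] mu] by simp
    then have "lnorm ?F 0 (T u) < 1" using \<delta>(2)[OF mu] u(2) by simp
    then have "L2_set (fst (T u)) {..<k} + lnorm W 0 (snd (T u)) < 1"
      by (simp add: sc_sum_def sc_Rn_def case_prod_beta)
    moreover have "0 \<le> lnorm W 0 (snd (T u))"
      using T0[OF u(1)] by (intro lnorm_nonneg[OF W]) (auto simp: F0)
    moreover have "fst (T u) i \<le> L2_set (fst (T u)) {..<k}" using i by (intro member_le_L2_set) auto
    ultimately show ?thesis by linarith
  qed
  have upper: "fst (T x) i \<le> 2 / \<delta> * lnorm E 0 x" if x: "x \<in> level E 0" and i: "i < k" for x i
  proof (cases "x = 0")
    case True
    have "T 0 = 0" using linear_on_set_diff[OF sub lin subspace_0[OF sub] subspace_0[OF sub]] by simp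
    then show ?thesis using True by (simp add: lnorm_0[OF E])
  next
    case False
    define t where "t = lnorm E 0 x"
    have t: "t > 0" using lnorm_nonneg[OF E x] lnorm_eq_0[OF E x] False by (simp add: t_def)
    have "fst (T ((\<delta> / (2 * t)) *\<^sub>R x)) i \<le> 1"
      using x t \<delta>(1) by (intro small i subspace_scale[OF sub]) (auto simp: lnorm_scaleR[OF E x] t_def)
    moreover have "T ((\<delta> / (2 * t)) *\<^sub>R x) = (\<delta> / (2 * t)) *\<^sub>R T x"
      using lin x by (simp add: linear_on_set_def)
    ultimately have "\<delta> / (2 * t) * fst (T x) i \<le> 1" by (simp add: scaleR_fun_def)
    then show ?thesis using t \<delta>(1) by (simp add: field_simps t_def)
  qed
  have bound: "\<bar>fst (T x) i\<bar> \<le> 2 / \<delta> * lnorm E 0 x" if x: "x \<in> level E 0" and i: "i < k" for x i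
  proof -
    have "T ((-1) *\<^sub>R x) = (-1) *\<^sub>R T x" using lin x unfolding linear_on_set_def by blast
    then have "- fst (T x) i \<le> 2 / \<delta> * lnorm E 0 x"
      using upper[OF subspace_scale[OF sub x, of "-1"] i] lnorm_scaleR[OF E x, of "-1"]
      by (simp add: scaleR_fun_def)
    then show ?thesis using upper[OF x i] by simp
  qed
  have mem: "x \<in> C \<longleftrightarrow> (\<forall>i<k. 0 \<le> fst (T x) i)" if x: "x \<in> level E 0" for x
  proof -
    have "x \<in> C \<longleftrightarrow> T x \<in> T ` C"
      using inj_on_image_mem_iff[OF bij_betw_imp_inj_on[OF bij] x C] by simp
    also have "\<dots> \<longleftrightarrow> (\<forall>i<k. 0 \<le> fst (T x) i)"
      using T0[OF x] unfolding TC F0 by (auto simp: sc_Rn_def mem_Times_iff)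
    finally show ?thesis .
  qed
  have "\<exists>x\<in>level E 0. \<forall>i<k. fst (T x) i = r i" for r
  proof -
    define p where "p = (\<lambda>i. if i < k then r i else 0, 0 :: 'a)"
    have "p \<in> level ?F 0"
      using subspace_0[OF subspace_level[OF W]] by (simp add: F0 p_def)
    then have "p \<in> T ` level E 0" by (simp only: bij_betw_imp_surj_on[OF bij])
    then obtain x where "p = T x" "x \<in> level E 0" by (rule imageE)
    then show ?thesis by (intro bexI[of _ x]) (auto simp: p_def dest: sym)
  qed
  moreover have "linear_on_set (level E 0) (\<lambda>x. fst (T x) i)" for i
    using lin by (simp add: linear_on_set_def scaleR_fun_def)
  moreover have "C = {x \<in> level E 0. \<forall>i<k. 0 \<le> fst (T x) i}" using mem C by blast
  moreover have "\<exists>B. \<forall>x\<in>level E 0. \<bar>fst (T x) i\<bar> \<le> B * lnorm E 0 x" if "i < k" for i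
    using bound that by (intro exI[of _ "2 / \<delta>"]) simp
  ultimately show ?thesis
    unfolding quadrant_coordinates_def by simp
qed

lemma
  assumes E: "normed_levels E" and "quadrant_coordinates E C k l"
  shows coordinate_linear: "i < k \<Longrightarrow> linear_on_set (level E 0) (l i)"
    and coordinate_bounded: "i < k \<Longrightarrow> \<exists>B>0. \<forall>x\<in>level E 0. \<bar>l i x\<bar> \<le> B * lnorm E 0 x"
    and quadrant_iff: "x \<in> C \<longleftrightarrow> x \<in> level E 0 \<and> (\<forall>i<k. 0 \<le> l i x)"
    and coordinates_surj: "\<exists>x\<in>level E 0. \<forall>i<k. l i x = r i"
proof -
  show "i < k \<Longrightarrow> linear_on_set (level E 0) (l i)" "x \<in> C \<longleftrightarrow> x \<in> level E 0 \<and> (\<forall>i<k. 0 \<le> l i x)"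
    "\<exists>x\<in>level E 0. \<forall>i<k. l i x = r i"
    using assms unfolding quadrant_coordinates_def by blast+
  assume i: "i < k"
  then obtain B where B: "\<And>x. x \<in> level E 0 \<Longrightarrow> \<bar>l i x\<bar> \<le> B * lnorm E 0 x"
    using assms unfolding quadrant_coordinates_def by blast
  have "\<bar>l i x\<bar> \<le> (\<bar>B\<bar> + 1) * lnorm E 0 x" if x: "x \<in> level E 0" for x
    using B[OF x] mult_right_mono[of B "\<bar>B\<bar> + 1", OF _ lnorm_nonneg[OF E x]] by linarith
  then show "\<exists>B>0. \<forall>x\<in>level E 0. \<bar>l i x\<bar> \<le> B * lnorm E 0 x"
    by (intro exI[of _ "\<bar>B\<bar> + 1"]) auto
qed

definition active_coordinates :: "nat \<Rightarrow> (nat \<Rightarrow> 'a \<Rightarrow> real) \<Rightarrow> 'a \<Rightarrow> nat set" where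
  "active_coordinates k l x = {i. i < k \<and> l i x = 0}"

lemma finite_active_coordinates [simp]: "finite (active_coordinates k l x)"
  by (simp add: active_coordinates_def)

text \<open>Only active coordinates can become negative immediately.\<close>

lemma ray_in_quadrant:
  assumes E: "normed_levels E" and l: "quadrant_coordinates E C k l"
    and x: "x \<in> C" and h: "h \<in> level E 0"
    and pos: "\<And>i. i \<in> active_coordinates k l x \<Longrightarrow> 0 \<le> l i h"
  shows "\<exists>\<tau>>0. \<forall>t\<in>{0..\<tau>}. x + t *\<^sub>R h \<in> C"
proof -
  note sub = subspace_level[OF E]
  have x0: "x \<in> level E 0" and lx: "\<And>i. i < k \<Longrightarrow> 0 \<le> l i x" using x quadrant_iff[OF E l] by auto
  have lin: "l i (x + t *\<^sub>R h) = l i x + t * l i h" if "i < k" for i t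
    using coordinate_linear[OF E l that] x0 h subspace_scale[OF sub h] by (simp add: linear_on_set_def)
  have "\<forall>\<^sub>F t in at_right 0. 0 \<le> l i x + t * l i h" if i: "i < k" for i
  proof (cases "l i x = 0")
    case True
    then have "0 \<le> l i h" using pos i by (simp add: active_coordinates_def)
    then show ?thesis using True by (auto simp: eventually_at_right_less intro: eventually_at_rightI[of 0 1])
  next
    case False
    have "((\<lambda>t. l i x + t * l i h) \<longlongrightarrow> l i x + 0 * l i h) (at_right 0)"
      by (intro tendsto_intros)
    moreover have "0 < l i x + 0 * l i h" using lx[OF i] False by simp
    ultimately have "\<forall>\<^sub>F t in at_right 0. 0 < l i x + t * l i h" by (rule order_tendstoD(1))
    then show ?thesis by eventually_elim simp
  qed
  then have "\<forall>\<^sub>F t in at_right 0. \<forall>i\<in>{..<k}. 0 \<le> l i x + t * l i h"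
    by (intro eventually_ball_finite) auto
  then obtain b where b: "b > 0" "\<And>t. 0 < t \<Longrightarrow> t < b \<Longrightarrow> \<forall>i<k. 0 \<le> l i x + t * l i h"
    unfolding eventually_at_right_field by auto
  have "x + t *\<^sub>R h \<in> C" if "t \<in> {0..b / 2}" for t
  proof (cases "t = 0")
    case False
    then show ?thesis
      using b that lin x0 h
      by (auto simp: quadrant_iff[OF E l] intro!: subspace_add[OF sub] subspace_scale[OF sub])
  qed (use x in simp)
  then show ?thesis using b(1) by (intro exI[of _ "b / 2"]) auto
qed

lemma relatively_openD:
  assumes E: "normed_levels E" and C: "C \<subseteq> level E 0" and U: "relatively_open E C U" and x: "x \<in> U"
  shows "\<exists>\<delta>>0. \<forall>z\<in>C. lnorm E 0 (z - x) < \<delta> \<longrightarrow> z \<in> U"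
proof -
  interpret Metric_space "level E 0" "level_dist E 0" using E by (rule Metric_space_level)
  obtain S where S: "openin mtopology S" "U = S \<inter> C"
    using U by (auto simp: relatively_open_def openin_subtopology level_top_def)
  then obtain \<delta> where \<delta>: "\<delta> > 0" "mball x \<delta> \<subseteq> S" using x unfolding openin_mtopology by blast
  have "z \<in> U" if z: "z \<in> C" "lnorm E 0 (z - x) < \<delta>" for z
  proof -
    have zx: "z \<in> level E 0" "x \<in> level E 0" using z x S(2) C by auto
    have "z \<in> mball x \<delta>" using zx z(2) lnorm_minus_commute[OF E zx] by (simp add: level_dist_def)
    then show ?thesis using \<delta>(2) S(2) z(1) by blast
  qed
  then show ?thesis using \<delta>(1) by blast
qed

lemma ray_in_relatively_open:
  assumes E: "normed_levels E" and l: "quadrant_coordinates E C k l"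
    and U: "relatively_open E C U" and x: "x \<in> U" and h: "h \<in> level E 0"
    and pos: "\<And>i. i \<in> active_coordinates k l x \<Longrightarrow> 0 \<le> l i h"
  shows "\<exists>\<tau>>0. \<forall>t\<in>{0..\<tau>}. x + t *\<^sub>R h \<in> U"
proof -
  have C: "C \<subseteq> level E 0" using quadrant_iff[OF E l] by blast
  have UC: "U \<subseteq> C" using U by (auto simp: relatively_open_def openin_subtopology)
  obtain \<delta> where \<delta>: "\<delta> > 0" "\<And>z. z \<in> C \<Longrightarrow> lnorm E 0 (z - x) < \<delta> \<Longrightarrow> z \<in> U"
    using relatively_openD[OF E C U x] by blast
  have "x \<in> C" using x UC by blast
  then obtain \<tau> where \<tau>: "\<tau> > 0" "\<And>t. t \<in> {0..\<tau>} \<Longrightarrow> x + t *\<^sub>R h \<in> C"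
    using ray_in_quadrant[OF E l _ h pos] by blast
  let ?N = "lnorm E 0 h + 1"
  have N: "?N > 0" using lnorm_nonneg[OF E h] by simp
  have "x + t *\<^sub>R h \<in> U" if t: "t \<in> {0..min \<tau> (\<delta> / (2 * ?N))}" for t
  proof (rule \<delta>(2))
    show "x + t *\<^sub>R h \<in> C" using t by (intro \<tau>(2)) auto
    have "t * lnorm E 0 h \<le> t * ?N" using t by (intro mult_left_mono) auto
    also have "\<dots> \<le> \<delta> / (2 * ?N) * ?N" using t N by (intro mult_right_mono) auto
    also have "\<dots> = \<delta> / 2" using N by (simp add: divide_simps)
    also have "\<dots> < \<delta>" using \<delta>(1) by simp
    finally show "lnorm E 0 (x + t *\<^sub>R h - x) < \<delta>" using t by (simp add: lnorm_scaleR[OF E h])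
  qed
  then show ?thesis using \<tau>(1) \<delta>(1) N by (intro exI[of _ "min \<tau> (\<delta> / (2 * ?N))"]) auto
qed

text \<open>The cone of points with positive coordinates spans everything: already the coordinate vectors
  \<open>(1, \<dots>, 1)\<close> and \<open>(1, \<dots>, 1) + e\<^sub>p\<close> force \<open>c p = 0\<close>. The restriction to this cone matters later, where only
  directions pointing into the quadrant are available.\<close>

lemma active_coordinates_independent:
  assumes E: "normed_levels E" and l: "quadrant_coordinates E C k l" and J: "J \<subseteq> {..<k}"
    and c: "\<And>v. v \<in> level E 0 \<Longrightarrow> (\<forall>i<k. 0 < l i v) \<Longrightarrow> (\<Sum>j\<in>J. c j * l j v) = 0"
  shows "\<forall>j\<in>J. c j = 0"
proof
  fix p assume p: "p \<in> J"
  have fin: "finite J" using J finite_subset by blast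
  have "(\<Sum>j\<in>J. c j * r j) = 0" if r: "\<And>i. 0 < r i" for r
  proof -
    obtain v where v: "v \<in> level E 0" "\<forall>i<k. l i v = r i" using coordinates_surj[OF E l] by blast
    have "(\<Sum>j\<in>J. c j * l j v) = (\<Sum>j\<in>J. c j * r j)" using v(2) J by (intro sum.cong) auto
    then show ?thesis using c[of v] v r by simp
  qed
  from this[of "\<lambda>_. 1"] this[of "\<lambda>j. 1 + (if j = p then 1 else 0)"]
  show "c p = 0" using p fin by (simp add: distrib_left sum.distrib if_distrib[of "\<lambda>x. _ * x"] cong: if_cong)
qed

text \<open>The common kernel of the active coordinates at \<open>x\<close> consists of the directions \<open>h\<close> for which both \<open>h\<close> and
  \<open>- h\<close> point from \<open>x\<close> into \<open>C\<close>. It depends on \<open>C\<close> and \<open>x\<close> only, not on the coordinates.\<close>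

lemma card_active_coordinates_le:
  assumes E: "normed_levels E" and l: "quadrant_coordinates E C k l" and l': "quadrant_coordinates E C k' l'"
    and x: "x \<in> C"
  shows "card (active_coordinates k' l' x) \<le> card (active_coordinates k l x)"
proof (rule card_le_of_common_kernel[of _ _ "level E 0" l l'])
  note sub = subspace_level[OF E]
  have x0: "x \<in> level E 0" using x quadrant_iff[OF E l] by blast
  have nonneg: "0 \<le> l' j h" if h: "h \<in> level E 0" and pos: "\<And>i. i \<in> active_coordinates k l x \<Longrightarrow> 0 \<le> l i h"
    and j: "j \<in> active_coordinates k' l' x" for j h
  proof -
    obtain \<tau> where \<tau>: "\<tau> > 0" "\<And>t. t \<in> {0..\<tau>} \<Longrightarrow> x + t *\<^sub>R h \<in> C"
      using ray_in_quadrant[OF E l x h pos] by blast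
    have "x + \<tau> *\<^sub>R h \<in> C" using \<tau> by auto
    then have "0 \<le> l' j (x + \<tau> *\<^sub>R h)" using j quadrant_iff[OF E l'] by (auto simp: active_coordinates_def)
    also have "\<dots> = \<tau> * l' j h"
      using coordinate_linear[OF E l', of j] j x0 h subspace_scale[OF sub h]
      by (simp add: linear_on_set_def active_coordinates_def)
    finally show ?thesis using \<tau>(1) by (simp add: zero_le_mult_iff)
  qed
  fix h j assume h: "h \<in> level E 0" and ker: "\<And>i. i \<in> active_coordinates k l x \<Longrightarrow> l i h = 0"
    and j: "j \<in> active_coordinates k' l' x"
  have "l i ((-1) *\<^sub>R h) = - l i h" if "i < k" for i
    using coordinate_linear[OF E l that] h unfolding linear_on_set_def by (metis mult_minus1 real_scaleR_def)
  then have "0 \<le> l' j ((-1) *\<^sub>R h)"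
    using ker by (intro nonneg subspace_scale[OF sub h] j) (auto simp: active_coordinates_def)
  also have "\<dots> = - l' j h"
    using coordinate_linear[OF E l', of j] h j unfolding linear_on_set_def active_coordinates_def
    by (metis (mono_tags) mem_Collect_eq mult_minus1 real_scaleR_def)
  finally show "l' j h = 0" using nonneg[OF h _ j] ker by force
next
  show "\<forall>j\<in>active_coordinates k' l' x. c j = 0"
    if "\<And>v. v \<in> level E 0 \<Longrightarrow> (\<Sum>j\<in>active_coordinates k' l' x. c j * l' j v) = 0" for c
    by (rule active_coordinates_independent[OF E l']) (use that in \<open>auto simp: active_coordinates_def\<close>)
qed (auto simp: active_coordinates_def subspace_level[OF E] coordinate_linear[OF E l] coordinate_linear[OF E l'])

lemma degeneration_index_coordinates:
  assumes E: "normed_levels E" and C: "partial_quadrant E C"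
  shows "\<exists>k l. quadrant_coordinates E C k l \<and>
    (\<forall>x\<in>C. degeneration_index E C x = card (active_coordinates k l x))"
proof -
  have C0: "C \<subseteq> level E 0"
    using C closedin_subset[of "level_top E 0" C] topspace_level_top[OF E] by (simp add: partial_quadrant_def)
  obtain k W T where chart: "quadrant_chart E C k W T" using C by (auto simp: partial_quadrant_def)
  define l where "l = (\<lambda>i x. fst (T x) i)"
  have l: "quadrant_coordinates E C k l"
    using quadrant_chart_coordinates[OF E C0 chart] by (simp add: l_def)
  have "degeneration_index E C x = card (active_coordinates k l x)" if x: "x \<in> C" for x
    unfolding degeneration_index_def
  proof (rule the_equality)
    show "\<exists>k' W T. quadrant_chart E C k' W T \<and>
        card (active_coordinates k l x) = card {i. i < k' \<and> fst (T x) i = 0}"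
      using chart by (auto simp: active_coordinates_def l_def)
    fix d assume "\<exists>k W T. quadrant_chart E C k W T \<and> d = card {i. i < k \<and> fst (T x) i = 0}"
    then obtain k' W' T' where chart': "quadrant_chart E C k' W' T'"
      and d: "d = card (active_coordinates k' (\<lambda>i x. fst (T' x) i) x)"
      by (auto simp: active_coordinates_def)
    note l' = quadrant_chart_coordinates[OF E C0 chart']
    show "d = card (active_coordinates k l x)"
      unfolding d using card_active_coordinates_le[OF E l l' x] card_active_coordinates_le[OF E l' l x]
      by (rule antisym)
  qed
  then show ?thesis using l by blast
qed

section \<open>Derivatives of maps between quadrants\<close>

text \<open>Along the ray \<open>x + t h\<close> the value of \<open>l' j \<circ> \<phi>\<close> starts at \<open>0\<close> and stays nonnegative.\<close>

lemma sc_derivative_into_quadrant_nonneg: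
  assumes E: "normed_levels E" and F: "normed_levels F"
    and l: "quadrant_coordinates E C k l" and l': "quadrant_coordinates F C' k' l'"
    and U: "relatively_open E C U" and \<phi>: "\<And>z. z \<in> U \<Longrightarrow> \<phi> z \<in> C'"
    and D: "has_sc_derivative E U F \<phi> x D"
    and x: "x \<in> U \<inter> level E 1" and h: "h \<in> level E 1"
    and pos: "\<And>i. i \<in> active_coordinates k l x \<Longrightarrow> 0 \<le> l i h"
    and j: "j \<in> active_coordinates k' l' (\<phi> x)"
  shows "0 \<le> l' j (D h)"
proof (rule ccontr)
  assume neg: "\<not> 0 \<le> l' j (D h)"
  define a where "a = - l' j (D h)"
  have a: "a > 0" using neg by (simp add: a_def)
  have jk: "j < k'" "l' j (\<phi> x) = 0" using j by (auto simp: active_coordinates_def)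
  note sub = subspace_level[OF E] and subF = subspace_level[OF F]
  have h0: "h \<in> level E 0" using h level_antimono[OF E, of 0 1] by auto
  have \<phi>0: "\<phi> z \<in> level F 0" if "z \<in> U" for z using \<phi>[OF that] quadrant_iff[OF F l'] by blast
  obtain \<tau> where \<tau>: "\<tau> > 0" "\<And>t. t \<in> {0..\<tau>} \<Longrightarrow> x + t *\<^sub>R h \<in> U"
    using ray_in_relatively_open[OF E l U _ h0 pos] x by blast
  have "curve_derivative F 0 {0..\<tau>} (\<lambda>t. \<phi> (x + t *\<^sub>R h)) (D h) 0"
    using D \<tau> \<phi>0 x h
    by (intro curve_derivative_compose[OF E F, where U = U] curve_derivative_line[OF E])
      (auto intro!: subspace_add[OF sub] subspace_scale[OF sub])
  moreover obtain B where B: "B > 0" "\<And>v. v \<in> level F 0 \<Longrightarrow> \<bar>l' j v\<bar> \<le> B * lnorm F 0 v"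
    using coordinate_bounded[OF F l' jk(1)] by blast
  moreover have "a / (2 * B) > 0" using a B(1) by simp
  ultimately obtain d where d: "d > 0" "\<And>t. t \<in> {0..\<tau>} \<Longrightarrow> \<bar>t - 0\<bar> < d \<Longrightarrow>
      lnorm F 0 (\<phi> (x + t *\<^sub>R h) - \<phi> (x + 0 *\<^sub>R h) - (t - 0) *\<^sub>R D h) \<le> a / (2 * B) * \<bar>t - 0\<bar>"
    unfolding curve_derivative_def by meson
  define t where "t = min \<tau> (d / 2)"
  have t: "t > 0" "t \<in> {0..\<tau>}" "t < d" using \<tau>(1) d(1) by (auto simp: t_def)
  let ?v = "\<phi> (x + t *\<^sub>R h) - \<phi> x - t *\<^sub>R D h"
  have lev: "\<phi> (x + t *\<^sub>R h) \<in> level F 0" "\<phi> x \<in> level F 0" "D h \<in> level F 0"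
    using \<tau>(2)[OF t(2)] x \<phi>0 has_sc_derivative_level[OF D h0] by auto
  note lin = coordinate_linear[OF F l' jk(1)]
  have "l' j ?v = l' j (\<phi> (x + t *\<^sub>R h)) - l' j (\<phi> x) - t * l' j (D h)"
    using linear_on_set_diff[OF subF lin subspace_diff[OF subF lev(1,2)] subspace_scale[OF subF lev(3), of t]]
      linear_on_set_diff[OF subF lin lev(1,2)] lin lev(3) by (simp add: linear_on_set_def)
  moreover have "0 \<le> l' j (\<phi> (x + t *\<^sub>R h))"
    using \<phi>[OF \<tau>(2)[OF t(2)]] quadrant_iff[OF F l'] jk(1) by blast
  ultimately have "t * a \<le> l' j ?v" using jk(2) by (simp add: a_def)
  also have "\<dots> \<le> B * lnorm F 0 ?v"
    using B(2)[of ?v] lev by (simp add: subspace_diff[OF subF] subspace_scale[OF subF])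
  also have "\<dots> \<le> B * (a / (2 * B) * t)"
    using d(2)[OF t(2)] t B(1) by (intro mult_left_mono) auto
  also have "\<dots> = t * a / 2" using B(1) by simp
  finally show False using t(1) a by simp
qed

lemma sc_derivative_into_quadrant_eq_0:
  assumes E: "normed_levels E" and F: "normed_levels F"
    and l: "quadrant_coordinates E C k l" and l': "quadrant_coordinates F C' k' l'"
    and U: "relatively_open E C U" and \<phi>: "\<And>z. z \<in> U \<Longrightarrow> \<phi> z \<in> C'"
    and D: "has_sc_derivative E U F \<phi> x D"
    and x: "x \<in> U \<inter> level E 1" and h: "h \<in> level E 1"
    and ker: "\<And>i. i \<in> active_coordinates k l x \<Longrightarrow> l i h = 0"
    and j: "j \<in> active_coordinates k' l' (\<phi> x)"
  shows "l' j (D h) = 0"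
proof (rule antisym)
  note nonneg = sc_derivative_into_quadrant_nonneg[OF E F l l' U \<phi> D x _ _ j]
  have jk: "j < k'" using j by (simp add: active_coordinates_def)
  have h0: "h \<in> level E 0" using h level_antimono[OF E, of 0 1] by auto
  show "0 \<le> l' j (D h)" using nonneg[OF _ h] ker by simp
  have "l i ((-1) *\<^sub>R h) = - l i h" if "i < k" for i
    using coordinate_linear[OF E l that] h0 unfolding linear_on_set_def by (metis mult_minus1 real_scaleR_def)
  then have "0 \<le> l' j (D ((-1) *\<^sub>R h))"
    using ker by (intro nonneg subspace_scale[OF subspace_level[OF E] h]) (auto simp: active_coordinates_def)
  also have "D ((-1) *\<^sub>R h) = (-1) *\<^sub>R D h"
    using D h0 unfolding has_sc_derivative_def linear_on_set_def by blast
  also have "l' j ((-1) *\<^sub>R D h) = - l' j (D h)"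
    using coordinate_linear[OF F l' jk] has_sc_derivative_level[OF D h0]
    unfolding linear_on_set_def by (metis mult_minus1 real_scaleR_def)
  finally show "l' j (D h) \<le> 0" by simp
qed

text \<open>Every coordinate is nonnegative on \<open>b\<close> and on \<open>- b\<close> for \<open>b\<close> in \<open>G\<close>, hence vanishes there. So a vector \<open>v\<close> and its
  component in \<open>K\<close> have the same coordinates, and the component is a limit of smooth points of \<open>K\<close>, whose
  coordinates are eventually positive as well.\<close>

lemma active_coordinates_independent_on_summand:
  assumes E: "normed_levels E" and l: "quadrant_coordinates E C k l"
    and KG: "sc_complement E K G" and G: "G \<subseteq> C" and J: "J \<subseteq> {..<k}"
    and c: "\<And>v. v \<in> K \<inter> smooth_points E \<Longrightarrow> (\<forall>i<k. 0 < l i v) \<Longrightarrow> (\<Sum>j\<in>J. c j * l j v) = 0"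
  shows "\<forall>j\<in>J. c j = 0"
proof (rule active_coordinates_independent[OF E l J])
  fix v assume v: "v \<in> level E 0" and pos: "\<forall>i<k. 0 < l i v"
  note sub = subspace_level[OF E]
  have K0: "K \<subseteq> level E 0" and G0: "G \<subseteq> level E 0"
    and KB: "sc_Banach (sc_restrict E K)" and GB: "sc_Banach (sc_restrict E G)"
    and bij: "bij_betw (\<lambda>(a, b). a + b) (level (sc_sum (sc_restrict E K) (sc_restrict E G)) 0) (level E 0)"
    using KG by (auto simp: sc_complement_def sc_isomorphism_def)
  have "v \<in> (\<lambda>(a, b). a + b) ` level (sc_sum (sc_restrict E K) (sc_restrict E G)) 0"
    using v by (simp only: bij_betw_imp_surj_on[OF bij])
  then obtain a b where ab: "v = a + b" "a \<in> K" "b \<in> G"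
    by (auto simp: sc_sum_def sc_restrict_def)
  have a0: "a \<in> level E 0" and b0: "b \<in> level E 0" using ab K0 G0 by auto
  have "level E 0 \<inter> G = G" using G0 by blast
  then have "subspace G"
    using subspace_level[OF sc_Banach_normed[OF GB], of 0] by (simp add: sc_restrict_def)
  then have bG: "(-1) *\<^sub>R b \<in> G" using ab(3) by (rule subspace_scale)
  have la: "l i a = l i v" if i: "i < k" for i
  proof -
    have "0 \<le> l i b" "0 \<le> l i ((-1) *\<^sub>R b)" using ab(3) bG G quadrant_iff[OF E l] i by auto
    moreover have "l i ((-1) *\<^sub>R b) = - l i b"
      using coordinate_linear[OF E l i] b0 unfolding linear_on_set_def by (metis mult_minus1 real_scaleR_def)
    ultimately have "l i b = 0" by simp
    then show ?thesis
      using coordinate_linear[OF E l i] a0 b0 by (simp add: ab(1) linear_on_set_def)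
  qed
  let ?R = "sc_restrict E K"
  note R = sc_Banach_normed[OF KB]
  interpret Metric_space "level ?R 0" "level_dist ?R 0" using R by (rule Metric_space_level)
  have smR: "smooth_points ?R = K \<inter> smooth_points E"
    by (auto simp: smooth_points_def sc_restrict_def)
  have "a \<in> level ?R 0" using ab a0 by (simp add: sc_restrict_def)
  then have closure: "a \<in> mtopology closure_of smooth_points ?R"
    using KB by (simp add: sc_Banach_def level_top_def)
  have "\<exists>y\<in>K \<inter> smooth_points E. lnorm E 0 (a - y) < e" if "e > 0" for e
  proof -
    obtain y where "y \<in> K \<inter> smooth_points E" "y \<in> mball a e"
      using \<open>e > 0\<close> closure unfolding metric_closure_of smR by blast
    moreover from this have "lnorm ?R 0 (a - y) < e"
      unfolding in_mball level_dist_def by auto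
    ultimately show ?thesis by (intro bexI[of _ y]) (simp_all add: sc_restrict_def)
  qed
  then have "\<forall>n. \<exists>y\<in>K \<inter> smooth_points E. lnorm E 0 (a - y) < 1 / Suc n" by simp
  then obtain y where y: "\<And>n. y n \<in> K \<inter> smooth_points E" "\<And>n::nat. lnorm E 0 (a - y n) < 1 / Suc n"
    by metis
  have lim: "(\<lambda>n. l i (y n)) \<longlonglongrightarrow> l i v" if i: "i < k" for i
  proof -
    obtain B where B: "B > 0" "\<And>v. v \<in> level E 0 \<Longrightarrow> \<bar>l i v\<bar> \<le> B * lnorm E 0 v"
      using coordinate_bounded[OF E l i] by blast
    have "norm (l i a - l i (y n)) \<le> B * (1 / Suc n)" for n
    proof -
      have yn: "y n \<in> level E 0" using y(1)[of n] K0 by auto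
      have "\<bar>l i (a - y n)\<bar> \<le> B * lnorm E 0 (a - y n)" by (rule B(2)[OF subspace_diff[OF sub a0 yn]])
      also have "\<dots> \<le> B * (1 / Suc n)" using y(2)[of n] B(1) by (intro mult_left_mono) auto
      finally show ?thesis
        using linear_on_set_diff[OF sub coordinate_linear[OF E l i] a0 yn] by simp
    qed
    moreover have "(\<lambda>n. B * (1 / Suc n)) \<longlonglongrightarrow> B * 0"
      by (intro tendsto_intros LIMSEQ_Suc[OF lim_1_over_n])
    ultimately have "(\<lambda>n. l i a - l i (y n)) \<longlonglongrightarrow> 0"
      using Lim_null_comparison[of "\<lambda>n. l i a - l i (y n)" "\<lambda>n. B * (1 / Suc n)" sequentially] by simp
    from tendsto_diff[OF tendsto_const[of "l i a"] this] show ?thesis by (simp add: la[OF i])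
  qed
  have "\<forall>\<^sub>F n in sequentially. 0 < l i (y n)" if "i < k" for i
    using order_tendstoD(1)[OF lim[OF that]] pos that by blast
  then have "\<forall>\<^sub>F n in sequentially. \<forall>i\<in>{..<k}. 0 < l i (y n)"
    by (intro eventually_ball_finite) auto
  then have "\<forall>\<^sub>F n in sequentially. (\<Sum>j\<in>J. c j * l j (y n)) = 0"
    by eventually_elim (use c y(1) in auto)
  then have "(\<lambda>n. \<Sum>j\<in>J. c j * l j (y n)) \<longlonglongrightarrow> 0" by (rule tendsto_eventually)
  moreover have "(\<lambda>n. \<Sum>j\<in>J. c j * l j (y n)) \<longlonglongrightarrow> (\<Sum>j\<in>J. c j * l j v)"
    using J by (intro tendsto_intros lim) auto
  ultimately show "(\<Sum>j\<in>J. c j * l j v) = 0" using LIMSEQ_unique by blast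
qed

lemma sc_curveD:
  assumes "sc_curve E \<tau> \<gamma> \<gamma>'" "s \<in> {0..\<tau>}"
  shows "\<gamma> s \<in> level E m" "\<gamma>' s \<in> level E m" "curve_derivative E m {0..\<tau>} \<gamma> (\<gamma>' s) s"
  using assms unfolding sc_curve_def by blast+

text \<open>The curve \<open>r (y + t h)\<close> starts with velocity \<open>D h = h\<close>. It is its own image under \<open>\<phi> \<circ> \<psi>\<close>, so the
  velocity that the chain rule gives for that image is \<open>h\<close> as well. The velocity of the intermediate curve
  \<open>\<psi> (r (y + t h))\<close> lies in every level, which permits the second application of the chain rule.
  The derivatives \<open>D\<close> and \<open>Dr y\<close> of \<open>r\<close> at \<open>y\<close> may come from different sources; both describe the
  velocity of the same curve.\<close>

lemma derivative_right_inverse: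
  assumes E: "sc_Banach E" and F: "sc_Banach F"
    and \<phi>: "sc1_with E U F V \<phi> D\<phi>" and \<psi>: "sc1_with F U' E V' \<psi> D\<psi>" and r: "sc1_with F W F V'' r Dr"
    and comp: "\<And>z. z \<in> W \<Longrightarrow> r z \<in> U' \<and> \<psi> (r z) \<in> U \<and> \<phi> (\<psi> (r z)) = r z"
    and y: "y \<in> smooth_points F" "r y = y" and h: "h \<in> smooth_points F" "D h = h"
    and D: "has_sc_derivative F W F r y D"
    and \<tau>: "\<tau> > 0" and ray: "\<And>t. t \<in> {0..\<tau>} \<Longrightarrow> y + t *\<^sub>R h \<in> W"
  shows "D\<psi> y h \<in> level E m \<and> D\<phi> (\<psi> y) (D\<psi> y h) = h"
proof -
  note nE = sc_Banach_normed[OF E] and nF = sc_Banach_normed[OF F]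
  note line = sc_curve_line[OF nF y(1) h(1), of \<tau>]
  have 0: "(0::real) \<in> {0..\<tau>}" using \<tau> by simp
  have sm: "y \<in> level F m" "h \<in> level F m" for m using y h by (auto simp: smooth_points_def)
  have rU: "r (y + t *\<^sub>R h) \<in> U'" "\<psi> (r (y + t *\<^sub>R h)) \<in> U"
    and ret: "\<phi> (\<psi> (r (y + t *\<^sub>R h))) = r (y + t *\<^sub>R h)" if "t \<in> {0..\<tau>}" for t
    using comp[OF ray[OF that]] by auto
  have \<rho>: "sc_curve F \<tau> (\<lambda>t. r (y + t *\<^sub>R h)) (\<lambda>t. Dr (y + t *\<^sub>R h) h)"
    by (rule sc_curve_compose[OF nF F r line]) (rule ray)
  have \<sigma>: "sc_curve E \<tau> (\<lambda>t. \<psi> (r (y + t *\<^sub>R h))) (\<lambda>t. D\<psi> (r (y + t *\<^sub>R h)) (Dr (y + t *\<^sub>R h) h))"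
    by (rule sc_curve_compose[OF nF E \<psi> \<rho>]) (rule rU(1))
  have \<omega>: "sc_curve F \<tau> (\<lambda>t. \<phi> (\<psi> (r (y + t *\<^sub>R h))))
      (\<lambda>t. D\<phi> (\<psi> (r (y + t *\<^sub>R h))) (D\<psi> (r (y + t *\<^sub>R h)) (Dr (y + t *\<^sub>R h) h)))"
    by (rule sc_curve_compose[OF nE F \<phi> \<sigma>]) (rule rU(2))
  note \<rho>D = sc_curveD[OF \<rho>] and \<sigma>D = sc_curveD[OF \<sigma>] and \<omega>D = sc_curveD[OF \<omega>]
  have "curve_derivative F 0 {0..\<tau>} (\<lambda>t. r (y + t *\<^sub>R h)) (D h) 0"
  proof (rule curve_derivative_compose[OF nF nF _ 0, where U = W and \<phi> = r and D = D and v = h and \<gamma> = "\<lambda>t. y + t *\<^sub>R h"])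
    show "has_sc_derivative F W F r (y + 0 *\<^sub>R h) D" using D by simp
    show "y + t *\<^sub>R h \<in> W \<inter> level F 1" if "t \<in> {0..\<tau>}" for t
      using ray[OF that] sm by (simp add: subspace_add subspace_scale subspace_level[OF nF])
  qed (use \<rho>D sm curve_derivative_line[OF nF] in auto)
  then have dr: "curve_derivative F 0 {0..\<tau>} (\<lambda>t. r (y + t *\<^sub>R h)) h 0" by (simp add: h(2))
  have "curve_derivative F 0 {0..\<tau>} (\<lambda>t. r (y + t *\<^sub>R h)) (Dr y h) 0" "Dr y h \<in> level F 0"
    using \<rho>D(2,3)[OF 0, of 0] by simp_all
  then have Dr: "Dr y h = h"
    using curve_derivative_unique[OF nF \<tau> _ sm(2)[of 0] \<rho>D(1) _ dr] by blast
  have "curve_derivative F 0 {0..\<tau>} (\<lambda>t. \<phi> (\<psi> (r (y + t *\<^sub>R h)))) (D\<phi> (\<psi> y) (D\<psi> y h)) 0"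
    and lev': "D\<phi> (\<psi> y) (D\<psi> y h) \<in> level F 0"
    using \<omega>D(2,3)[OF 0, of 0] by (simp_all add: y(2) Dr)
  then have "curve_derivative F 0 {0..\<tau>} (\<lambda>t. r (y + t *\<^sub>R h)) (D\<phi> (\<psi> y) (D\<psi> y h)) 0"
    using ret[OF 0] by (simp add: curve_derivative_def ret)
  then have "D\<phi> (\<psi> y) (D\<psi> y h) = h"
    using curve_derivative_unique[OF nF \<tau> lev' sm(2)[of 0] \<rho>D(1) _ dr] by blast
  moreover have "D\<psi> y h \<in> level E m"
    using \<sigma>D(2)[OF 0, of m] by (simp add: y(2) Dr)
  ultimately show ?thesis by blast
qed

section \<open>Invariance of the degeneration index\<close>

lemma sc1_chart:
  assumes E: "normed_levels E" and F: "normed_levels F" and C: "C \<subseteq> level E 0"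
    and f: "model_sc_map 1 Q C E Q' F f"
  shows "\<exists>U r D. relatively_open E C U \<and> r ` U = Q \<and> Q \<subseteq> U \<and> (\<forall>x\<in>Q. r x = x) \<and>
    sc1_with E U F (level F 0) (f \<circ> r) D"
proof -
  obtain U r where r: "sc_smooth_retraction E C U r" and Q: "Q = r ` U"
    and fr: "sc_map 1 E U F (level F 0) (f \<circ> r)"
    using f by (auto simp: model_sc_map_def)
  have U: "relatively_open E C U" and idem: "\<And>x. x \<in> U \<Longrightarrow> r (r x) = r x" and "sc_map 0 E U E U r"
    using r by (auto simp: sc_smooth_retraction_def sc_smooth_def)
  then have "sc0 E U E U r" by (simp add: sc_map_0[OF E E])
  moreover have "U \<subseteq> level E 0" using U C by (auto simp: relatively_open_def openin_subtopology)
  ultimately have "r ` U \<subseteq> U" unfolding sc0_iff[OF E E] by blast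
  moreover obtain D where "sc1_with E U F (level F 0) (f \<circ> r) D"
    using fr unfolding sc_map_1_iff[OF E F] by blast
  ultimately show ?thesis using U Q idem by (intro exI[of _ U] exI[of _ r] exI[of _ D]) auto
qed

text \<open>The functionals compared are the active \<open>l i\<close> and the compositions of the active \<open>l' j\<close> with the
  derivative of \<open>f \<circ> r\<close> at \<open>x\<close>. They are considered on level \<open>1\<close>, since the increments in the definition of the
  derivative are taken from there. The retractions that witness differentiability of \<open>f\<close> and of \<open>g\<close>
  need not be the one, here \<open>\<rho>\<close>, that provides the complement.\<close>

lemma card_active_coordinates_smooth_le:
  assumes Q: "local_model Q C E" and Q': "local_model Q' C' E'"
    and f: "model_sc_map 1 Q C E Q' E' f" and g: "model_sc_map 1 Q' C' E' Q E g"
    and fg: "\<And>y. y \<in> Q' \<Longrightarrow> f (g y) = y" and gf: "\<And>x. x \<in> Q \<Longrightarrow> g (f x) = x"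
    and l: "quadrant_coordinates E C k l" and l': "quadrant_coordinates E' C' k' l'"
    and x: "x \<in> Q \<inter> smooth_points E"
  shows "f x \<in> smooth_points E'"
    and "card (active_coordinates k' l' (f x)) \<le> card (active_coordinates k l x)"
proof -
  have E: "sc_Banach E" and E': "sc_Banach E'" and QC: "Q \<subseteq> C" and QC': "Q' \<subseteq> C'"
    using Q Q' by (auto simp: local_model_def)
  note nE = sc_Banach_normed[OF E] and nE' = sc_Banach_normed[OF E']
  have C0: "C \<subseteq> level E 0" using quadrant_iff[OF nE l] by blast
  have C0': "C' \<subseteq> level E' 0" using quadrant_iff[OF nE' l'] by blast
  have fQ: "f z \<in> Q'" if "z \<in> Q" for z using f that unfolding model_sc_map_def by blast
  have gQ: "g z \<in> Q" if "z \<in> Q'" for z using g that unfolding model_sc_map_def by blast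
  obtain U r D where U: "relatively_open E C U" and rU: "r ` U = Q" "Q \<subseteq> U" "\<And>x. x \<in> Q \<Longrightarrow> r x = x"
    and D: "sc1_with E U E' (level E' 0) (f \<circ> r) D"
    using sc1_chart[OF nE nE' C0 f] by blast
  obtain U' r' D' where rU': "r' ` U' = Q'" "Q' \<subseteq> U'" "\<And>y. y \<in> Q' \<Longrightarrow> r' y = y"
    and D': "sc1_with E' U' E (level E 0) (g \<circ> r') D'"
    using sc1_chart[OF nE' nE C0' g] by blast
  have xQ: "x \<in> Q" and xU: "x \<in> U" and xm: "\<And>m. x \<in> level E m"
    using x rU(2) by (auto simp: smooth_points_def)
  have "(f \<circ> r) x \<in> level E' m" for m
  proof -
    have "sc0 E U E' (level E' 0) (f \<circ> r)" using D by (simp add: sc1_with_def)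
    then show ?thesis using xU xm[of m] unfolding sc0_iff[OF nE nE'] by blast
  qed
  then show y: "f x \<in> smooth_points E'" by (simp add: rU(3)[OF xQ] smooth_points_def)
  have yQ: "f x \<in> Q'" using fQ[OF xQ] .
  have "\<exists>W \<rho>. sc_smooth_retraction E' C' W \<rho> \<and> Q' = \<rho> ` W \<and>
      (\<forall>y \<in> Q' \<inter> smooth_points E'. \<exists>D. has_sc_derivative E' W E' \<rho> y D \<and>
           (\<exists>G. sc_complement E' {h \<in> level E' 0. h - D h = 0} G \<and> G \<subseteq> C'))"
    using Q' unfolding local_model_def by blast
  then obtain W \<rho> D\<rho> G where \<rho>: "sc_smooth_retraction E' C' W \<rho>" and Q'\<rho>: "Q' = \<rho> ` W"
    and D\<rho>: "has_sc_derivative E' W E' \<rho> (f x) D\<rho>"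
    and G: "sc_complement E' {h \<in> level E' 0. h - D\<rho> h = 0} G" "G \<subseteq> C'"
    using yQ y by blast
  have W: "relatively_open E' C' W" and idem: "\<And>y. y \<in> W \<Longrightarrow> \<rho> (\<rho> y) = \<rho> y"
    and \<rho>01: "sc_map 0 E' W E' W \<rho>" "sc_map 1 E' W E' W \<rho>"
    using \<rho> by (auto simp: sc_smooth_retraction_def sc_smooth_def)
  have "W \<subseteq> level E' 0" using W C0' by (auto simp: relatively_open_def openin_subtopology)
  then have \<rho>W: "\<rho> ` W \<subseteq> W"
    using \<rho>01(1) unfolding sc_map_0[OF nE' nE'] sc0_iff[OF nE' nE'] by blast
  have yW: "f x \<in> W" and \<rho>y: "\<rho> (f x) = f x" using yQ Q'\<rho> \<rho>W idem by auto
  obtain D'' where D'': "sc1_with E' W E' W \<rho> D''"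
    using \<rho>01(2) unfolding sc_map_1_iff[OF nE' nE'] by blast
  have Dx: "has_sc_derivative E U E' (f \<circ> r) x (D x)"
    using D xU xm by (simp add: sc1_with_def)
  have frx: "(f \<circ> r) x = f x" by (simp add: rU(3)[OF xQ])
  have nest: "level E 1 \<subseteq> level E 0" using level_antimono[OF nE, of 0 1] by simp
  show "card (active_coordinates k' l' (f x)) \<le> card (active_coordinates k l x)"
  proof (rule card_le_of_common_kernel[of _ _ "level E 1" l "\<lambda>j h. l' j (D x h)"])
    show "linear_on_set (level E 1) (l i)" if "i \<in> active_coordinates k l x" for i
      using coordinate_linear[OF nE l] that linear_on_set_subset[OF _ nest]
      by (auto simp: active_coordinates_def)
    show "linear_on_set (level E 1) (\<lambda>h. l' j (D x h))" if "j \<in> active_coordinates k' l' (f x)" for j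
    proof -
      have lin: "linear_on_set (level E' 0) (l' j)"
        using coordinate_linear[OF nE' l', of j] that by (simp add: active_coordinates_def)
      have linD: "linear_on_set (level E 0) (D x)" using Dx by (simp add: has_sc_derivative_def)
      have "D x h \<in> level E' 0" if "h \<in> level E 1" for h
        using has_sc_derivative_level[OF Dx] that nest by blast
      then show ?thesis
        using lin linD nest unfolding linear_on_set_def by (simp add: subset_iff)
    qed
    show "l' j (D x h) = 0"
      if "h \<in> level E 1" "\<And>i. i \<in> active_coordinates k l x \<Longrightarrow> l i h = 0"
        "j \<in> active_coordinates k' l' (f x)" for h j
    proof (rule sc_derivative_into_quadrant_eq_0[OF nE nE' l l' U _ Dx])
      show "(f \<circ> r) z \<in> C'" if "z \<in> U" for z using fQ rU(1) that QC' by auto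
      show "j \<in> active_coordinates k' l' ((f \<circ> r) x)" using that(3) unfolding frx .
    qed (use that xU xm in auto)
    show "\<forall>j\<in>active_coordinates k' l' (f x). c j = 0"
      if c: "\<And>h. h \<in> level E 1 \<Longrightarrow> (\<Sum>j\<in>active_coordinates k' l' (f x). c j * l' j (D x h)) = 0" for c
    proof (rule active_coordinates_independent_on_summand[OF nE' l' G])
      \<comment> \<open>Positivity of the coordinates of \<open>h\<close> lets the ray from \<open>f x\<close> enter the quadrant.\<close>
      fix h assume h: "h \<in> {h \<in> level E' 0. h - D\<rho> h = 0} \<inter> smooth_points E'" and pos: "\<forall>i<k'. 0 < l' i h"
      then obtain \<tau> where \<tau>: "\<tau> > 0" "\<And>t. t \<in> {0..\<tau>} \<Longrightarrow> f x + t *\<^sub>R h \<in> W"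
        using ray_in_relatively_open[OF nE' l' W yW, of h] by (auto simp: active_coordinates_def less_imp_le)
      have "D' (f x) h \<in> level E 1 \<and> D ((g \<circ> r') (f x)) (D' (f x) h) = h"
      proof (rule derivative_right_inverse[OF E E' D D' D'' _ y \<rho>y _ _ D\<rho> \<tau>])
        show "\<rho> z \<in> U' \<and> (g \<circ> r') (\<rho> z) \<in> U \<and> (f \<circ> r) ((g \<circ> r') (\<rho> z)) = \<rho> z" if z: "z \<in> W" for z
        proof -
          have "\<rho> z \<in> Q'" using z Q'\<rho> by blast
          then show ?thesis using rU rU' gQ fg by (auto simp: subset_iff)
        qed
      qed (use h in auto)
      then have "D' (f x) h \<in> level E 1" "D x (D' (f x) h) = h"
        by (simp_all add: rU'(3)[OF yQ] gf[OF xQ])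
      then show "(\<Sum>j\<in>active_coordinates k' l' (f x). c j * l' j h) = 0" using c by metis
    qed (auto simp: active_coordinates_def)
  qed (simp_all add: subspace_level[OF nE])
qed

text \<open>A coordinate that is positive at \<open>x\<close> stays positive nearby.\<close>

lemma active_coordinates_semicontinuous:
  assumes E: "normed_levels E" and l: "quadrant_coordinates E C k l" and x: "x \<in> C"
  shows "\<exists>e>0. \<forall>z\<in>C. lnorm E 0 (x - z) < e \<longrightarrow> active_coordinates k l z \<subseteq> active_coordinates k l x"
proof -
  have "\<exists>e>0. \<forall>z\<in>C. lnorm E 0 (x - z) < e \<longrightarrow> l i z = 0 \<longrightarrow> l i x = 0" if i: "i < k" for i
  proof -
    obtain B where B: "B > 0" "\<And>v. v \<in> level E 0 \<Longrightarrow> \<bar>l i v\<bar> \<le> B * lnorm E 0 v"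
      using coordinate_bounded[OF E l i] by blast
    show ?thesis
    proof (cases "l i x = 0")
      case False
      have "l i z \<noteq> 0" if z: "z \<in> C" "lnorm E 0 (x - z) < \<bar>l i x\<bar> / B" for z
      proof
        assume "l i z = 0"
        have xz: "x \<in> level E 0" "z \<in> level E 0" using x z quadrant_iff[OF E l] by auto
        have "\<bar>l i x\<bar> = \<bar>l i (x - z)\<bar>"
          using linear_on_set_diff[OF subspace_level[OF E] coordinate_linear[OF E l i] xz] \<open>l i z = 0\<close> by simp
        also have "\<dots> \<le> B * lnorm E 0 (x - z)"
          using xz by (intro B(2) subspace_diff[OF subspace_level[OF E]])
        also have "\<dots> < \<bar>l i x\<bar>" using z(2) B(1) by (simp add: field_simps)
        finally show False by simp
      qed
      then show ?thesis using False B(1) by (intro exI[of _ "\<bar>l i x\<bar> / B"]) auto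
    qed (auto intro: exI[of _ 1])
  qed
  then obtain e where e: "\<And>i. i < k \<Longrightarrow> e i > 0"
    "\<And>i z. i < k \<Longrightarrow> z \<in> C \<Longrightarrow> lnorm E 0 (x - z) < e i \<Longrightarrow> l i z = 0 \<Longrightarrow> l i x = 0"
    by metis
  have "active_coordinates k l z \<subseteq> active_coordinates k l x"
    if z: "z \<in> C" "lnorm E 0 (x - z) < Min (insert 1 (e ` {..<k}))" for z
    using e(2)[OF _ z(1)] z(2) by (auto simp: active_coordinates_def)
  moreover have "Min (insert 1 (e ` {..<k})) > 0" using e(1) by (auto simp: Min_gr_iff)
  ultimately show ?thesis by blast
qed

text \<open>The smooth case is applied to \<open>g\<close>, at the images of smooth points \<open>s n\<close> that converge to \<open>x\<close> and have the
  index of \<open>x\<close>; semicontinuity at \<open>f x\<close> does the rest.\<close>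

lemma degeneration_index_le:
  assumes Q: "local_model Q C E" and Q': "local_model Q' C' E'"
    and f: "model_sc_map 1 Q C E Q' E' f" and g: "model_sc_map 1 Q' C' E' Q E g"
    and fg: "\<And>y. y \<in> Q' \<Longrightarrow> f (g y) = y" and gf: "\<And>x. x \<in> Q \<Longrightarrow> g (f x) = x"
    and x: "x \<in> Q"
  shows "degeneration_index E C x \<le> degeneration_index E' C' (f x)"
proof -
  have E: "sc_Banach E" and E': "sc_Banach E'" and QC: "Q \<subseteq> C" and QC': "Q' \<subseteq> C'"
    and pC: "partial_quadrant E C" and pC': "partial_quadrant E' C'"
    using Q Q' by (auto simp: local_model_def)
  note nE = sc_Banach_normed[OF E] and nE' = sc_Banach_normed[OF E']
  obtain k l where l: "quadrant_coordinates E C k l"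
    and d: "\<And>x. x \<in> C \<Longrightarrow> degeneration_index E C x = card (active_coordinates k l x)"
    using degeneration_index_coordinates[OF nE pC] by blast
  obtain k' l' where l': "quadrant_coordinates E' C' k' l'"
    and d': "\<And>x. x \<in> C' \<Longrightarrow> degeneration_index E' C' x = card (active_coordinates k' l' x)"
    using degeneration_index_coordinates[OF nE' pC'] by blast
  have C0: "C \<subseteq> level E 0" using quadrant_iff[OF nE l] by auto
  have fQ: "f z \<in> Q'" if "z \<in> Q" for z using f that unfolding model_sc_map_def by blast
  have smooth: "card (active_coordinates k l z) \<le> card (active_coordinates k' l' (f z))"
    if z: "z \<in> Q \<inter> smooth_points E" for z
  proof -
    have fz: "f z \<in> Q' \<inter> smooth_points E'"
      using card_active_coordinates_smooth_le(1)[OF Q Q' f g fg gf l l' z] fQ z by blast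
    show ?thesis
      using card_active_coordinates_smooth_le(2)[OF Q' Q g f gf fg l' l fz] gf z by simp
  qed
  have "\<exists>s. (\<forall>n::nat. s n \<in> Q \<inter> smooth_points E \<and>
                       degeneration_index E C (s n) = degeneration_index E C x) \<and>
        limitin (subtopology (level_top E 0) Q) s x sequentially"
    using Q x unfolding local_model_def by blast
  then obtain s where s: "\<And>n. s n \<in> Q \<inter> smooth_points E"
    and ds: "\<And>n. degeneration_index E C (s n) = degeneration_index E C x"
    and lim: "limitin (level_top E 0) s x sequentially"
    by (auto simp: limitin_subtopology)
  obtain U r D where rU: "Q \<subseteq> U" "\<And>x. x \<in> Q \<Longrightarrow> r x = x"
    and D: "sc1_with E U E' (level E' 0) (f \<circ> r) D"
    using sc1_chart[OF nE nE' C0 f] by metis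
  obtain e where e: "e > 0" "\<And>z. z \<in> C' \<Longrightarrow> lnorm E' 0 (f x - z) < e \<Longrightarrow>
      active_coordinates k' l' z \<subseteq> active_coordinates k' l' (f x)"
    using active_coordinates_semicontinuous[OF nE' l', of "f x"] fQ[OF x] QC' by blast
  have "sc0 E U E' (level E' 0) (f \<circ> r)" using D by (simp add: sc1_with_def)
  moreover have "x \<in> level E 0 \<inter> U" using x QC C0 rU by blast
  ultimately obtain \<delta> where \<delta>: "\<delta> > 0" "\<And>y. y \<in> level E 0 \<inter> U \<Longrightarrow> lnorm E 0 (x - y) < \<delta> \<Longrightarrow>
      lnorm E' 0 ((f \<circ> r) x - (f \<circ> r) y) < e"
    using e(1) unfolding sc0_iff[OF nE nE'] by blast
  interpret Metric_space "level E 0" "level_dist E 0" using nE by (rule Metric_space_level)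
  have "\<forall>\<^sub>F n in sequentially. s n \<in> level E 0 \<and> level_dist E 0 (s n) x < \<delta>"
    using lim \<delta>(1) unfolding level_top_def limitin_metric by blast
  then obtain n where n: "s n \<in> level E 0" "level_dist E 0 (s n) x < \<delta>"
    by (auto simp: eventually_sequentially)
  have x0: "x \<in> level E 0" using x QC C0 by blast
  have "lnorm E 0 (x - s n) < \<delta>"
    using n x0 lnorm_minus_commute[OF nE n(1) x0] by (simp add: level_dist_def)
  then have "lnorm E' 0 (f x - f (s n)) < e"
    using \<delta>(2)[of "s n"] n s[of n] rU x by auto
  then have "active_coordinates k' l' (f (s n)) \<subseteq> active_coordinates k' l' (f x)"
    using e(2) fQ s[of n] QC' by blast
  then have "card (active_coordinates k' l' (f (s n))) \<le> card (active_coordinates k' l' (f x))"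
    by (intro card_mono) simp
  moreover have "degeneration_index E C x = card (active_coordinates k l (s n))"
    using ds[of n] d[of "s n"] s[of n] QC by auto
  moreover have "degeneration_index E' C' (f x) = card (active_coordinates k' l' (f x))"
    using d'[of "f x"] fQ[OF x] QC' by blast
  ultimately show ?thesis using smooth[OF s[of n]] by linarith
qed

theorem theorem1p19:
  fixes E :: "'a::real_vector sc_space" and E' :: "'b::real_vector sc_space"
    and C Q :: "'a set" and C' Q' :: "'b set" and f :: "'a \<Rightarrow> 'b"
  assumes "local_model Q C E" and "local_model Q' C' E'"
    and "sc_diffeomorphism Q C E Q' C' E' f"
  shows "\<forall>x\<in>Q. degeneration_index E C x = degeneration_index E' C' (f x)"
proof
  fix x assume x: "x \<in> Q"
  let ?g = "inv_into Q f"
  have bij: "bij_betw f Q Q'" and f: "model_sc_map 1 Q C E Q' E' f" and g: "model_sc_map 1 Q' C' E' Q E ?g"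
    using assms(3) by (simp_all add: sc_diffeomorphism_def)
  have gf: "?g (f z) = z" if "z \<in> Q" for z using bij that by (simp add: bij_betw_inv_into_left)
  have fg: "f (?g y) = y" if "y \<in> Q'" for y using bij that by (simp add: bij_betw_inv_into_right)
  have "f x \<in> Q'" using bij x by (auto simp: bij_betw_def)
  then have "degeneration_index E' C' (f x) \<le> degeneration_index E C (?g (f x))"
    using degeneration_index_le[OF assms(2,1) g f gf fg] by blast
  moreover have "degeneration_index E C x \<le> degeneration_index E' C' (f x)"
    by (rule degeneration_index_le[OF assms(1,2) f g fg gf x])
  ultimately show "degeneration_index E C x = degeneration_index E' C' (f x)" by (simp add: gf[OF x])
qed

end
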